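(* Let $\kappa$ be a regular uncountable cardinal and $K$ a streamlined $\kappa$-tree. (1) If $\mathrm P(\kappa,2,{\sqsubseteq^*},1)$ holds, then there exists a normal and splitting streamlined $\kappa$-Souslin tree $T$ such that $V(T)\supseteq V^-(K)$. (2) If $\mathrm P(\kappa,\kappa,{\sqsubseteq},1)$ holds, then there exists a normal and splitting streamlined $\kappa$-Souslin tree $T$ such that $V(T)\supseteq V^-(K)\cap E^\kappa_{>\omega}$.
   Context: $H_\kappa$: sets of hereditary cardinality $<\kappa$. A streamlined $\kappa$-tree is a set $T\subseteq{}^{<\kappa}H_\kappa$ closed under restrictions with each $T_\alpha=T\cap{}^\alpha H_\kappa$ ($\alpha<\kappa$) nonempty of size $<\kappa$, viewed as the tree $(T,\subsetneq)$. Normal: for $\alpha<\beta<\kappa$, each node of level $\alpha$ has an extension in level $\beta$; splitting: each node has at least two immediate successors; $\kappa$-Souslin: no $\kappa$-branch and no antichain of size $\kappa$. An $\alpha$-branch: linearly ordered subset with set of heights $\alpha$; vanishing if no upper bound. $V^-(T)$: set of nonzero limit $\alpha<\kappa$ admitting a vanishing $\alpha$-branch; $V(T)$: set of nonzero limit $\alpha<\kappa$ such that every node of height $<\alpha$ lies on a vanishing $\alpha$-branch. $E^\kappa_{>\omega}=\{\alpha<\kappa\mid\mathrm{cf}(\alpha)>\omega\}$. For a set of ordinals $C$: $\mathrm{acc}(C)=\{\alpha\in C\mid\sup(C\cap\alpha)=\alpha>0\}$, $\mathrm{nacc}(C)=C\setminus\mathrm{acc}(C)$. $D\sqsubseteq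 C$ iff $D=C\cap\beta$ for some $\beta$; $D\sqsubseteq^*C$ iff $D\setminus\varepsilon\sqsubseteq C\setminus\varepsilon$ for some $\varepsilon<\sup(D)$. For a cardinal $\mu\le\kappa$ and relation $\mathcal R$, $\mathrm P(\kappa,\mu,\mathcal R,1)$ asserts that $\diamondsuit(\kappa)$ holds and there is a sequence $\langle\mathcal C_\alpha\mid\alpha<\kappa\rangle$ where each $\mathcal C_\alpha$ is a nonempty family of fewer than $\mu$ closed subsets $C$ of $\alpha$ with $\sup(C)=\sup(\alpha)$, such that for all $\alpha<\kappa$, $C\in\mathcal C_\alpha$ and $\bar\alpha\in\mathrm{acc}(C)$ there is $D\in\mathcal C_{\bar\alpha}$ with $D\mathrel{\mathcal R}C$, and for every cofinal $B\subseteq\kappa$ there are stationarily many $\alpha<\kappa$ with $\sup(\mathrm{nacc}(C)\cap B)=\alpha$ for all $C\in\mathcal C_\alpha$. *)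

theory Defs
  imports Main
begin

unbundle cardinal_syntax

text \<open>
  A cardinal \<open>\<kappa>\<close> is given by a well-ordered type \<open>'k\<close> whose order is a cardinal order:
  the ordinals below \<open>\<kappa>\<close> are the elements of \<open>'k\<close>, the ordinal \<open>\<alpha>\<close> as a set is
  \<open>{..<\<alpha>}\<close>, and \<open>\<kappa>\<close> as a set is \<open>UNIV\<close>.
\<close>

definition kappa :: "'k::wellorder rel" where
  "kappa = {(x, y). x \<le> y}"


subsection \<open>Sets of hereditary cardinality less than \<open>\<kappa>\<close>\<close>

text \<open>
  The type \<open>'k hset\<close> is the universe of all well-founded sets that hereditarily have at most
  \<open>\<kappa>\<close> elements, obtained from well-founded trees with branching indexed by \<open>'k\<close> modulo
  extensional equality. It contains every set of hereditary cardinality less than \<open>\<kappa>\<close>.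
\<close>

datatype 'k pset = PSet "'k \<rightharpoonup> 'k pset"

primrec pelems :: "'k pset \<Rightarrow> 'k pset set" where
  "pelems (PSet f) = ran f"

inductive ext_eq :: "'k pset \<Rightarrow> 'k pset \<Rightarrow> bool" where
  "\<forall>x\<in>pelems u. \<exists>y\<in>pelems v. ext_eq x y \<Longrightarrow>
   \<forall>y\<in>pelems v. \<exists>x\<in>pelems u. ext_eq x y \<Longrightarrow> ext_eq u v"

lemma pset_induct:
  assumes "\<And>u. (\<And>x. x \<in> pelems u \<Longrightarrow> P x) \<Longrightarrow> P u"
  shows "P u"
proof (induction u)
  case (PSet f)
  have "P x" if "x \<in> ran f" for x
  proof -
    from that obtain a where "f a = Some x" by (auto simp: ran_def)
    then show ?thesis using PSet.IH[of "f a" x] by (metis option.set_intros rangeI)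
  qed
  then show ?case using assms[of "PSet f"] by simp
qed

lemma ext_eq_refl: "ext_eq u u"
proof (induction u rule: pset_induct)
  case (1 u)
  show ?case by (rule ext_eq.intros) (use 1 in blast)+
qed

lemma ext_eqD:
  assumes "ext_eq u v"
  shows "x \<in> pelems u \<Longrightarrow> \<exists>y\<in>pelems v. ext_eq x y"
    and "y \<in> pelems v \<Longrightarrow> \<exists>x\<in>pelems u. ext_eq x y"
  using assms by (auto elim: ext_eq.cases)

lemma ext_eq_sym: "ext_eq u v \<Longrightarrow> ext_eq v u"
proof (induction rule: ext_eq.induct)
  case (1 u v)
  show ?case by (rule ext_eq.intros) (use 1 in blast)+
qed

lemma ext_eq_trans: "ext_eq u v \<Longrightarrow> ext_eq v w \<Longrightarrow> ext_eq u w"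
proof (induction arbitrary: w rule: ext_eq.induct)
  case (1 u v)
  show ?case
  proof (rule ext_eq.intros; rule ballI)
    fix x assume "x \<in> pelems u"
    then obtain y where "y \<in> pelems v" and IH: "\<And>z. ext_eq y z \<Longrightarrow> ext_eq x z"
      using 1(1) by blast
    then show "\<exists>z\<in>pelems w. ext_eq x z" using ext_eqD(1)[OF 1(3)] by blast
  next
    fix z assume "z \<in> pelems w"
    then obtain y where y: "y \<in> pelems v" "ext_eq y z" using ext_eqD(2)[OF 1(3)] by blast
    then show "\<exists>x\<in>pelems u. ext_eq x z" using 1(2) by blast
  qed
qed

quotient_type 'k hset = "'k pset" / ext_eq
  by (intro equivpI reflpI sympI transpI) (fact ext_eq_refl, fact ext_eq_sym, fact ext_eq_trans)

lift_definition hmem :: "'k hset \<Rightarrow> 'k hset \<Rightarrow> bool" is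
  "\<lambda>x u. \<exists>y\<in>pelems u. ext_eq x y"
proof -
  fix x x' u u' :: "'k pset"
  assume eq: "ext_eq x x'" "ext_eq u u'"
  show "(\<exists>y\<in>pelems u. ext_eq x y) = (\<exists>y\<in>pelems u'. ext_eq x' y)"
    by (meson eq ext_eqD ext_eq_sym ext_eq_trans)
qed

lemma hmem_abs: "hmem z (abs_hset u) \<longleftrightarrow> (\<exists>y\<in>pelems u. z = abs_hset y)"
proof -
  obtain v where "z = abs_hset v" by (metis Quotient_abs_rep[OF Quotient_hset])
  then show ?thesis by (simp add: hmem.abs_eq hset.abs_eq_iff)
qed

text \<open>The following four facts characterise \<open>('k hset, hmem)\<close> up to isomorphism.\<close>

lemma hset_ext:
  assumes "\<And>z. hmem z x \<longleftrightarrow> hmem z y"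
  shows "x = y"
proof -
  obtain u v where uv: "x = abs_hset u" "y = abs_hset v"
    by (metis Quotient_abs_rep[OF Quotient_hset])
  have "ext_eq u v"
  proof (rule ext_eq.intros)
    show "\<forall>a\<in>pelems u. \<exists>b\<in>pelems v. ext_eq a b"
      using assms by (auto simp: uv hmem_abs hset.abs_eq_iff[symmetric])
    show "\<forall>b\<in>pelems v. \<exists>a\<in>pelems u. ext_eq a b"
    proof
      fix b assume "b \<in> pelems v"
      then have "hmem (abs_hset b) y" by (auto simp: uv hmem_abs)
      then have "hmem (abs_hset b) x" using assms by simp
      then obtain a where "a \<in> pelems u" "abs_hset a = abs_hset b" by (auto simp: uv hmem_abs)
      then show "\<exists>a\<in>pelems u. ext_eq a b" by (auto simp: hset.abs_eq_iff)
    qed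
  qed
  then show ?thesis by (simp add: uv hset.abs_eq_iff)
qed

lemma hset_wf: "wfp (hmem :: 'k hset \<Rightarrow> 'k hset \<Rightarrow> bool)"
proof (rule wfpUNIVI)
  fix P :: "'k hset \<Rightarrow> bool" and x
  assume step: "\<forall>x. (\<forall>y. hmem y x \<longrightarrow> P y) \<longrightarrow> P x"
  have "P (abs_hset u)" for u
  proof (induction u rule: pset_induct)
    case (1 u)
    have "P y" if "hmem y (abs_hset u)" for y
      using that 1 by (auto simp: hmem_abs)
    then show ?case using step by blast
  qed
  then show "P x" by (metis Quotient_abs_rep[OF Quotient_hset])
qed

lemma hset_small: "|{z. hmem z x}| \<le>o |UNIV :: 'k set|" for x :: "'k hset"
proof -
  obtain f where u: "x = abs_hset (PSet f)"
    by (metis Quotient_abs_rep[OF Quotient_hset] pset.exhaust)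
  have "{z. hmem z x} \<subseteq> (\<lambda>a. abs_hset (the (f a))) ` UNIV"
  proof
    fix z assume "z \<in> {z. hmem z x}"
    then obtain y where "y \<in> ran f" "z = abs_hset y"
      by (auto simp: u hmem_abs)
    then obtain a where "z = abs_hset (the (f a))" by (auto simp: ran_def) (metis option.sel)
    then show "z \<in> (\<lambda>a. abs_hset (the (f a))) ` UNIV" by blast
  qed
  then show ?thesis
    by (rule ordLeq_transitive[OF card_of_mono1 card_of_image])
qed

lemma hset_comprehension:
  fixes A :: "'k hset set"
  assumes "|A| \<le>o |UNIV :: 'k set|"
  shows "\<exists>x. \<forall>z. hmem z x \<longleftrightarrow> z \<in> A"
proof -
  obtain g :: "'k hset \<Rightarrow> 'k" where g: "inj_on g A"
    using card_of_ordLeq[THEN iffD2, OF assms] by (elim exE conjE)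
  define f where "f a = (if a \<in> g ` A then Some (rep_hset (inv_into A g a)) else None)" for a
  have ran: "ran f = rep_hset ` A"
  proof
    show "ran f \<subseteq> rep_hset ` A"
      using g by (auto simp: f_def ran_def split: if_splits)
    show "rep_hset ` A \<subseteq> ran f"
    proof
      fix u assume "u \<in> rep_hset ` A"
      then obtain x where "x \<in> A" "u = rep_hset x" by blast
      then have "f (g x) = Some u" using g by (simp add: f_def)
      then show "u \<in> ran f" by (rule ranI)
    qed
  qed
  have "hmem z (abs_hset (PSet f)) \<longleftrightarrow> z \<in> A" for z
    by (simp add: hmem_abs ran Quotient_abs_rep[OF Quotient_hset])
  then show ?thesis by blast
qed

definition trcl :: "'k hset \<Rightarrow> 'k hset set" where
  "trcl x = {y. hmem\<^sup>+\<^sup>+ y x}"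

definition H_kappa :: "'k::wellorder hset set" where
  "H_kappa = {x. |trcl x| <o (kappa :: 'k rel)}"


subsection \<open>Ordinals below \<open>\<kappa>\<close>\<close>

definition ord_zero :: "'k::wellorder" where
  "ord_zero = (LEAST x. True)"

definition limit_ord :: "'k::wellorder \<Rightarrow> bool" where
  "limit_ord \<alpha> \<longleftrightarrow> ord_zero < \<alpha> \<and> (\<forall>\<beta><\<alpha>. \<exists>\<gamma><\<alpha>. \<beta> < \<gamma>)"

definition ord_omega :: "'k::wellorder" where
  "ord_omega = (LEAST \<alpha>. limit_ord \<alpha>)"

text \<open>The supremum of a set of ordinals; it is only meaningful for sets bounded below \<open>\<kappa>\<close>.\<close>

definition osup :: "'k::wellorder set \<Rightarrow> 'k" where
  "osup A = (LEAST \<beta>. \<forall>\<alpha>\<in>A. \<alpha> \<le> \<beta>)"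

definition cf :: "'k::wellorder \<Rightarrow> 'k" where
  "cf \<alpha> = (LEAST \<beta>. \<exists>f. f ` {..<\<beta>} \<subseteq> {..<\<alpha>} \<and> (\<forall>\<gamma><\<alpha>. \<exists>\<delta><\<beta>. \<gamma> \<le> f \<delta>))"

definition E_gt_omega :: "'k::wellorder set" where
  "E_gt_omega = {\<alpha>. ord_omega < cf \<alpha>}"

definition acc_pts :: "'k::wellorder set \<Rightarrow> 'k set" where
  "acc_pts C = {\<alpha>\<in>C. osup (C \<inter> {..<\<alpha>}) = \<alpha> \<and> ord_zero < \<alpha>}"

definition nacc_pts :: "'k::wellorder set \<Rightarrow> 'k set" where
  "nacc_pts C = C - acc_pts C"

text \<open>\<open>X\<close> is an ordinal \<open>\<le> \<kappa>\<close>, i.e. \<open>{..<\<alpha>}\<close> or \<open>UNIV\<close>; closedness is in its order topology.\<close>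

definition closed_subset :: "'k::wellorder set \<Rightarrow> 'k set \<Rightarrow> bool" where
  "closed_subset X C \<longleftrightarrow>
     C \<subseteq> X \<and> (\<forall>\<gamma>\<in>X. ord_zero < \<gamma> \<and> osup (C \<inter> {..<\<gamma>}) = \<gamma> \<longrightarrow> \<gamma> \<in> C)"

definition cofinal_kappa :: "'k::wellorder set \<Rightarrow> bool" where
  "cofinal_kappa B \<longleftrightarrow> (\<forall>\<alpha>. \<exists>\<beta>\<in>B. \<alpha> \<le> \<beta>)"

definition club :: "'k::wellorder set \<Rightarrow> bool" where
  "club C \<longleftrightarrow> closed_subset UNIV C \<and> cofinal_kappa C"

definition stationary :: "'k::wellorder set \<Rightarrow> bool" where
  "stationary S \<longleftrightarrow> (\<forall>C. club C \<longrightarrow> S \<inter> C \<noteq> {})"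

text \<open>The relations below are only applied to sets bounded in \<open>\<kappa>\<close>, so that \<open>\<beta> < \<kappa>\<close> suffices.\<close>

definition init_seg :: "'k::wellorder set \<Rightarrow> 'k set \<Rightarrow> bool"  (infix "\<sqsubseteq>\<^sub>i" 50) where
  "D \<sqsubseteq>\<^sub>i C \<longleftrightarrow> (\<exists>\<beta>. D = C \<inter> {..<\<beta>})"

definition init_seg_star :: "'k::wellorder set \<Rightarrow> 'k set \<Rightarrow> bool"  (infix "\<sqsubseteq>\<^sub>*" 50) where
  "D \<sqsubseteq>\<^sub>* C \<longleftrightarrow> (\<exists>\<epsilon> < osup D. (D - {..<\<epsilon>}) \<sqsubseteq>\<^sub>i (C - {..<\<epsilon>}))"


subsection \<open>Diamond and the proxy principle\<close>

definition diamond :: "'k::wellorder itself \<Rightarrow> bool" where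
  "diamond _ \<longleftrightarrow>
     (\<exists>S :: 'k \<Rightarrow> 'k set. (\<forall>\<alpha>. S \<alpha> \<subseteq> {..<\<alpha>}) \<and>
        (\<forall>A. stationary {\<alpha>. A \<inter> {..<\<alpha>} = S \<alpha>}))"

text \<open>\<open>proxy_P \<mu> R\<close> is \<open>P(\<kappa>, \<mu>, R, 1)\<close>.\<close>

definition proxy_P :: "'m rel \<Rightarrow> ('k::wellorder set \<Rightarrow> 'k set \<Rightarrow> bool) \<Rightarrow> bool" where
  "proxy_P \<mu> R \<longleftrightarrow>
     diamond TYPE('k) \<and>
     (\<exists>\<C> :: 'k \<Rightarrow> 'k set set.
        (\<forall>\<alpha>. \<C> \<alpha> \<noteq> {} \<and> |\<C> \<alpha>| <o \<mu> \<and>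
             (\<forall>C\<in>\<C> \<alpha>. closed_subset {..<\<alpha>} C \<and> osup C = osup {..<\<alpha>})) \<and>
        (\<forall>\<alpha>. \<forall>C\<in>\<C> \<alpha>. \<forall>\<alpha>'\<in>acc_pts C. \<exists>D\<in>\<C> \<alpha>'. R D C) \<and>
        (\<forall>B. cofinal_kappa B \<longrightarrow>
             stationary {\<alpha>. \<forall>C\<in>\<C> \<alpha>. osup (nacc_pts C \<inter> B) = \<alpha>}))"


subsection \<open>Streamlined trees\<close>

text \<open>
  A function with domain \<open>\<alpha> < \<kappa>\<close> is a partial map with domain \<open>{..<\<alpha>}\<close>, and inclusion of
  functions is \<open>(\<subseteq>\<^sub>m)\<close>.
\<close>

type_synonym 'k node = "'k \<rightharpoonup> 'k hset"

definition seqs :: "'k::wellorder \<Rightarrow> 'k node set" where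
  "seqs \<alpha> = {t. dom t = {..<\<alpha>} \<and> ran t \<subseteq> H_kappa}"

definition level :: "'k::wellorder node set \<Rightarrow> 'k \<Rightarrow> 'k node set" where
  "level T \<alpha> = T \<inter> seqs \<alpha>"

definition streamlined_tree :: "'k::wellorder node set \<Rightarrow> bool" where
  "streamlined_tree T \<longleftrightarrow>
     T \<subseteq> (\<Union>\<alpha>. seqs \<alpha>) \<and>
     (\<forall>t\<in>T. \<forall>\<beta>. t |` {..<\<beta>} \<in> T) \<and>
     (\<forall>\<alpha>. level T \<alpha> \<noteq> {} \<and> |level T \<alpha>| <o (kappa :: 'k rel))"

definition below :: "'k node \<Rightarrow> 'k node \<Rightarrow> bool"  (infix "\<subset>\<^sub>m" 50) where
  "s \<subset>\<^sub>m t \<longleftrightarrow> s \<subseteq>\<^sub>m t \<and> s \<noteq> t"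

definition ht :: "'k::wellorder node \<Rightarrow> 'k" where
  "ht t = (THE \<alpha>. dom t = {..<\<alpha>})"

lemma ht_eq: "dom t = {..<\<alpha>} \<Longrightarrow> ht t = \<alpha>"
  unfolding ht_def by (rule the_equality) auto

text \<open>
  \<open>ht t\<close> is the height of \<open>t\<close> in \<open>(T, \<subset>\<^sub>m)\<close>, i.e. the order type of its set of predecessors.
\<close>

lemma ht_order_type:
  assumes T: "streamlined_tree T" and t: "t \<in> T"
  shows "bij_betw ht {s\<in>T. s \<subset>\<^sub>m t} {..<ht t}"
    and "\<And>r s. r \<in> T \<Longrightarrow> s \<in> T \<Longrightarrow> r \<subset>\<^sub>m t \<Longrightarrow> s \<subset>\<^sub>m t \<Longrightarrow> r \<subset>\<^sub>m s \<longleftrightarrow> ht r < ht s"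
proof -
  have dom: "dom s = {..<ht s}" if s: "s \<in> T" for s
  proof -
    from T s obtain \<alpha> where "dom s = {..<\<alpha>}"
      by (auto simp: streamlined_tree_def seqs_def)
    then show ?thesis using ht_eq by metis
  qed
  have res: "s = t |` {..<ht s}" if "s \<in> T" "s \<subset>\<^sub>m t" for s
  proof
    fix x show "s x = (t |` {..<ht s}) x"
      using that dom[OF that(1)]
      by (cases "x < ht s") (auto simp: below_def map_le_def restrict_map_def)
  qed
  have lt: "ht s < ht t" if s: "s \<in> T" "s \<subset>\<^sub>m t" for s
  proof (rule ccontr)
    assume "\<not> ht s < ht t"
    then have "dom t \<subseteq> {..<ht s}" using dom[OF t] by auto
    then have "t |` {..<ht s} = t"
      by (intro ext) (metis domIff lessThan_iff restrict_map_def subsetD)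
    then show False using res[OF s] s(2) by (simp add: below_def)
  qed
  have ht_res: "ht (t |` {..<\<alpha>}) = \<alpha>" if "\<alpha> \<le> ht t" for \<alpha>
    using that dom[OF t] by (intro ht_eq) auto
  show "bij_betw ht {s\<in>T. s \<subset>\<^sub>m t} {..<ht t}"
  proof (rule bij_betw_imageI)
    show "inj_on ht {s\<in>T. s \<subset>\<^sub>m t}"
      by (rule inj_onI) (metis (mono_tags, lifting) mem_Collect_eq res)
    have "\<alpha> \<in> ht ` {s\<in>T. s \<subset>\<^sub>m t}" if \<alpha>: "\<alpha> < ht t" for \<alpha>
    proof -
      have h: "ht (t |` {..<\<alpha>}) = \<alpha>" using \<alpha> by (intro ht_res) simp
      moreover have "t |` {..<\<alpha>} \<in> T" using T t by (simp add: streamlined_tree_def)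
      moreover have "t |` {..<\<alpha>} \<noteq> t" using h \<alpha> by auto
      then have "t |` {..<\<alpha>} \<subset>\<^sub>m t"
        by (auto simp: below_def map_le_def restrict_map_def)
      ultimately show ?thesis by force
    qed
    then show "ht ` {s\<in>T. s \<subset>\<^sub>m t} = {..<ht t}" using lt by auto
  qed
  show "r \<subset>\<^sub>m s \<longleftrightarrow> ht r < ht s" if "r \<in> T" "s \<in> T" "r \<subset>\<^sub>m t" "s \<subset>\<^sub>m t" for r s
  proof
    assume rs: "r \<subset>\<^sub>m s"
    then have "dom r \<subseteq> dom s" by (simp add: below_def map_le_implies_dom_le)
    then have "ht r \<le> ht s" using dom that by auto
    moreover have "ht r \<noteq> ht s" using rs res that by (metis below_def)
    ultimately show "ht r < ht s" by simp
  next
    assume less: "ht r < ht s"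
    have "r \<subseteq>\<^sub>m s"
      unfolding map_le_def
    proof
      fix x assume "x \<in> dom r"
      then have "x < ht r" "x < ht s" using less dom[OF that(1)] by auto
      then show "r x = s x"
        using fun_cong[OF res[OF that(1,3)], of x] fun_cong[OF res[OF that(2,4)], of x]
        by simp
    qed
    then show "r \<subset>\<^sub>m s" using less by (auto simp: below_def)
  qed
qed

definition normal_tree :: "'k::wellorder node set \<Rightarrow> bool" where
  "normal_tree T \<longleftrightarrow>
     (\<forall>\<alpha> \<beta>. \<alpha> < \<beta> \<longrightarrow> (\<forall>s\<in>level T \<alpha>. \<exists>t\<in>level T \<beta>. s \<subset>\<^sub>m t))"

definition imm_succs :: "'k::wellorder node set \<Rightarrow> 'k node \<Rightarrow> 'k node set" where
  "imm_succs T s = {t\<in>T. s \<subset>\<^sub>m t \<and> \<not> (\<exists>u\<in>T. s \<subset>\<^sub>m u \<and> u \<subset>\<^sub>m t)}"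

definition splitting_tree :: "'k::wellorder node set \<Rightarrow> bool" where
  "splitting_tree T \<longleftrightarrow> (\<forall>s\<in>T. \<exists>t\<in>imm_succs T s. \<exists>u\<in>imm_succs T s. t \<noteq> u)"

text \<open>
  \<open>X\<close> is the ordinal \<open>{..<\<alpha>}\<close> for \<open>\<alpha>\<close>-branches and \<open>UNIV\<close> for \<open>\<kappa>\<close>-branches.
\<close>

definition branch :: "'k::wellorder node set \<Rightarrow> 'k set \<Rightarrow> 'k node set \<Rightarrow> bool" where
  "branch T X B \<longleftrightarrow>
     B \<subseteq> T \<and> (\<forall>s\<in>B. \<forall>t\<in>B. s \<subset>\<^sub>m t \<or> s = t \<or> t \<subset>\<^sub>m s) \<and> ht ` B = X"

definition antichain :: "'k::wellorder node set \<Rightarrow> 'k node set \<Rightarrow> bool" where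
  "antichain T A \<longleftrightarrow> A \<subseteq> T \<and> (\<forall>s\<in>A. \<forall>t\<in>A. \<not> s \<subset>\<^sub>m t)"

definition souslin_tree :: "'k::wellorder node set \<Rightarrow> bool" where
  "souslin_tree T \<longleftrightarrow>
     streamlined_tree T \<and>
     \<not> (\<exists>B. branch T UNIV B) \<and>
     \<not> (\<exists>A. antichain T A \<and> |A| =o (kappa :: 'k rel))"

definition vanishing :: "'k::wellorder node set \<Rightarrow> 'k node set \<Rightarrow> bool" where
  "vanishing T B \<longleftrightarrow> \<not> (\<exists>t\<in>T. \<forall>s\<in>B. s \<subseteq>\<^sub>m t)"

definition V_minus :: "'k::wellorder node set \<Rightarrow> 'k set" where
  "V_minus T = {\<alpha>. limit_ord \<alpha> \<and> (\<exists>B. branch T {..<\<alpha>} B \<and> vanishing T B)}"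

definition V_full :: "'k::wellorder node set \<Rightarrow> 'k set" where
  "V_full T =
     {\<alpha>. limit_ord \<alpha> \<and>
         (\<forall>s\<in>T. ht s < \<alpha> \<longrightarrow> (\<exists>B. branch T {..<\<alpha>} B \<and> vanishing T B \<and> s \<in> B))}"

end

theory Submission
  imports Defs
begin

text \<open>
  Both hypotheses give \<open>P(\<kappa>, \<kappa>, \<sqsubseteq>\<^sup>*, 1)\<close>, from which \<open>T\<close> is built level by level. A node of
  limit height \<open>\<alpha>\<close> is obtained from some \<open>C \<in> \<C> \<alpha>\<close>, some \<open>\<eta> \<in> K\<^sub>\<alpha>\<close> and a node whose height
  lies in \<open>C\<close> by climbing along \<open>C\<close>: at each \<open>\<delta> \<in> C\<close> one first appends a code of the restriction of
  \<open>\<eta>\<close> to \<open>\<delta>\<close> and then moves to the level of the next element of \<open>C\<close>, passing, if possible, through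
  the dense set guessed there by the diamond sequence. Coherence of the \<open>C\<close>-sequence keeps the climb
  inside \<open>T\<close> at accumulation points of \<open>C\<close>, and the hitting property of the \<open>C\<close>-sequence makes
  every dense subset of \<open>T\<close> sealed at some level, so \<open>T\<close> is Souslin.

  The same climb is possible along the limit \<open>\<eta>\<close> of a vanishing \<open>\<alpha>\<close>-branch of \<open>K\<close>. If the
  resulting branch had an upper bound in \<open>T\<close>, then it would also arise from some \<open>D \<in> \<C> \<alpha>\<close> and
  \<open>\<xi> \<in> K\<^sub>\<alpha>\<close>; decoding at the points of \<open>C \<inter> D\<close> yields \<open>\<eta> = \<xi> \<in> K\<close>, provided that \<open>C \<inter> D\<close> is
  cofinal in \<open>\<alpha>\<close>. This is trivial if \<open>\<C> \<alpha>\<close> is a singleton, and follows from closedness if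
  \<open>cf \<alpha> > \<omega>\<close>.
\<close>

section \<open>Regular uncountable cardinals\<close>

locale regular_uncountable =
  fixes ty :: "'k::wellorder itself"
  assumes Card_order_kappa: "Card_order (kappa :: 'k rel)"
    and regularCard_kappa: "regularCard (kappa :: 'k rel)"
    and uncountable_kappa: "natLeq <o (kappa :: 'k rel)"
begin

lemma Field_kappa: "Field (kappa :: 'k rel) = UNIV"
  by (auto simp: kappa_def Field_def)

lemma card_of_UNIV_kappa: "|UNIV :: 'k set| =o (kappa :: 'k rel)"
  using card_of_Field_ordIso[OF Card_order_kappa] by (simp add: Field_kappa)

lemma infinite_UNIV_kappa: "infinite (UNIV :: 'k set)"
proof -
  have "natLeq \<le>o |UNIV :: 'k set|"
    by (meson card_of_UNIV_kappa ordIso_symmetric ordLess_imp_ordLeq ordLess_ordIso_trans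
        uncountable_kappa)
  then show ?thesis
    using infinite_iff_natLeq_ordLeq by blast
qed

lemma Cinfinite_kappa: "Cinfinite (kappa :: 'k rel)"
proof
  show "cinfinite (kappa :: 'k rel)"
    by (simp add: cinfinite_def Field_kappa infinite_UNIV_kappa)
qed (rule Card_order_kappa)

lemma ex_greater: "\<exists>\<beta>::'k. \<alpha> < \<beta>"
proof -
  obtain \<beta> where "\<alpha> \<noteq> \<beta>" "(\<alpha>, \<beta>) \<in> (kappa :: 'k rel)"
    using infinite_Card_order_limit[OF Card_order_kappa, of \<alpha>] infinite_UNIV_kappa
    by (auto simp: Field_kappa)
  then have "\<alpha> < \<beta>" by (simp add: kappa_def)
  then show ?thesis ..
qed

section \<open>Sets of size less than \<kappa>\<close>

lemma small_lessThan: "|{..<\<alpha>::'k}| <o (kappa :: 'k rel)"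
proof -
  have "underS (kappa :: 'k rel) \<alpha> = {..<\<alpha>}"
    by (auto simp: underS_def kappa_def order_less_le)
  then show ?thesis
    using card_of_underS[OF Card_order_kappa, of \<alpha>] by (simp add: Field_kappa)
qed

lemma small_mono: "A \<subseteq> B \<Longrightarrow> |B| <o (kappa :: 'k rel) \<Longrightarrow> |A| <o (kappa :: 'k rel)"
  using card_of_mono1 ordLeq_ordLess_trans by blast

lemma small_image: "|A| <o (kappa :: 'k rel) \<Longrightarrow> |f ` A| <o (kappa :: 'k rel)"
  using card_of_image ordLeq_ordLess_trans by blast

lemma small_finite: "finite A \<Longrightarrow> |A| <o (kappa :: 'k rel)"
  using finite_iff_ordLess_natLeq ordLess_transitive uncountable_kappa by blast

lemma small_countable: "|range (f :: nat \<Rightarrow> 'a)| <o (kappa :: 'k rel)"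
  by (meson card_of_image card_of_nat ordLeq_ordIso_trans ordLeq_ordLess_trans uncountable_kappa)

lemma small_Un: "|A| <o (kappa :: 'k rel) \<Longrightarrow> |B| <o (kappa :: 'k rel) \<Longrightarrow> |A \<union> B| <o (kappa :: 'k rel)"
  using card_of_Un_ordLess_infinite_Field[OF _ Card_order_kappa]
  by (simp add: Field_kappa infinite_UNIV_kappa)

lemma small_UN:
  "|I| <o (kappa :: 'k rel) \<Longrightarrow> (\<And>i. i \<in> I \<Longrightarrow> |A i| <o (kappa :: 'k rel)) \<Longrightarrow>
    |\<Union>i\<in>I. A i| <o (kappa :: 'k rel)"
  using card_of_UNION_ordLess_infinite_Field_regularCard[OF regularCard_kappa Cinfinite_kappa]
  by blast

lemma small_Times:
  assumes "|A| <o (kappa :: 'k rel)" "|B| <o (kappa :: 'k rel)"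
  shows "|A \<times> B| <o (kappa :: 'k rel)"
proof -
  have "A \<times> B = (\<Union>a\<in>A. Pair a ` B)" by auto
  then show ?thesis using small_UN[OF assms(1)] small_image[OF assms(2)] by metis
qed

text \<open>This is regularity: a cofinal subset of \<kappa> has size \<kappa>. The negation of
  \<open>cofinal\<close> bounds \<open>X\<close> only weakly by \<open>a\<close>, so the strict
  bound is an ordinal beyond \<open>a\<close>.\<close>

lemma small_bounded:
  assumes "|X| <o (kappa :: 'k rel)"
  shows "\<exists>\<beta>::'k. \<forall>x\<in>X. x < \<beta>"
proof -
  have "\<not> cofinal X (kappa :: 'k rel)"
    using assms regularCard_kappa not_ordLess_ordIso
    unfolding regularCard_def Field_kappa by blast
  then obtain a where "\<forall>b\<in>X. b \<le> a"
    unfolding cofinal_def Field_kappa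
    by (metis (mono_tags, lifting) UNIV_I case_prodI kappa_def linear mem_Collect_eq order_refl)
  then show ?thesis using ex_greater[of a] by (meson le_less_trans)
qed

section \<open>Successor and limit ordinals\<close>

definition osuc :: "'k \<Rightarrow> 'k" where
  "osuc \<alpha> = (LEAST \<beta>. \<alpha> < \<beta>)"

lemma less_osuc: "\<alpha> < osuc \<alpha>"
  unfolding osuc_def using ex_greater by (rule LeastI_ex)

lemma osuc_le: "\<alpha> < \<beta> \<Longrightarrow> osuc \<alpha> \<le> \<beta>"
  unfolding osuc_def by (rule Least_le)

lemma less_osuc_iff: "\<beta> < osuc \<alpha> \<longleftrightarrow> \<beta> \<le> \<alpha>"
  using less_osuc osuc_le by (meson le_less_trans not_le)

lemma lessThan_osuc: "{..<osuc \<alpha>} = {..\<alpha>}"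
  by (auto simp: less_osuc_iff)

lemma ord_zero_le: "ord_zero \<le> (\<alpha>::'k)"
  unfolding ord_zero_def by (rule Least_le) simp

lemma not_less_ord_zero: "\<not> \<alpha> < (ord_zero::'k)"
  using ord_zero_le by (simp add: not_less)

lemma limit_ord_iff:
  "limit_ord (\<alpha>::'k) \<longleftrightarrow> \<alpha> \<noteq> ord_zero \<and> (\<nexists>\<gamma>. \<alpha> = osuc \<gamma>)"
proof
  assume L: "limit_ord \<alpha>"
  have "\<alpha> \<noteq> osuc \<gamma>" for \<gamma>
    using L less_osuc[of \<gamma>] unfolding limit_ord_def by (auto simp: less_osuc_iff)
  then show "\<alpha> \<noteq> ord_zero \<and> (\<nexists>\<gamma>. \<alpha> = osuc \<gamma>)"
    using L by (auto simp: limit_ord_def)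
next
  assume A: "\<alpha> \<noteq> ord_zero \<and> (\<nexists>\<gamma>. \<alpha> = osuc \<gamma>)"
  have "\<exists>\<gamma><\<alpha>. \<beta> < \<gamma>" if "\<beta> < \<alpha>" for \<beta>
    using that A osuc_le[OF that] less_osuc[of \<beta>] by (metis order_less_le)
  then show "limit_ord \<alpha>"
    using A ord_zero_le[of \<alpha>] by (auto simp: limit_ord_def order_less_le)
qed

lemma osuc_less_limit: "limit_ord \<alpha> \<Longrightarrow> \<beta> < \<alpha> \<Longrightarrow> osuc \<beta> < (\<alpha>::'k)"
  using osuc_le by (fastforce simp: limit_ord_def)

lemma not_limit_osuc: "\<not> limit_ord (osuc (\<alpha>::'k))"
  using limit_ord_iff by blast

lemma ord_cases [case_names zero succ limit]:
  obtains "(\<alpha>::'k) = ord_zero" | \<gamma> where "\<alpha> = osuc \<gamma>" | "limit_ord \<alpha>"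
  using limit_ord_iff by blast

section \<open>Suprema, accumulation points and closed sets\<close>

lemma osup_eq_iff:
  assumes "C \<subseteq> {..<\<alpha>::'k}"
  shows "osup C = \<alpha> \<longleftrightarrow> (\<forall>\<beta><\<alpha>. \<exists>\<gamma>\<in>C. \<beta> < \<gamma>)"
proof
  assume A: "osup C = \<alpha>"
  show "\<forall>\<beta><\<alpha>. \<exists>\<gamma>\<in>C. \<beta> < \<gamma>"
  proof (intro allI impI)
    fix \<beta> assume "\<beta> < \<alpha>"
    then have "\<not> (\<forall>\<gamma>\<in>C. \<gamma> \<le> \<beta>)"
      using A not_less_Least unfolding osup_def by blast
    then show "\<exists>\<gamma>\<in>C. \<beta> < \<gamma>" by (auto simp: not_le)
  qed
next
  assume A: "\<forall>\<beta><\<alpha>. \<exists>\<gamma>\<in>C. \<beta> < \<gamma>"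
  show "osup C = \<alpha>"
    unfolding osup_def
  proof (rule Least_equality)
    show "\<forall>\<gamma>\<in>C. \<gamma> \<le> \<alpha>" using assms by auto
    show "\<alpha> \<le> y" if "\<forall>\<gamma>\<in>C. \<gamma> \<le> y" for y
      using that A by (meson leD leI)
  qed
qed

lemma osup_lessThan_limit: "limit_ord \<alpha> \<Longrightarrow> osup {..<\<alpha>} = (\<alpha>::'k)"
  by (subst osup_eq_iff) (auto simp: limit_ord_def)

lemma osup_Int_eq_iff:
  "osup (C \<inter> {..<\<alpha>::'k}) = \<alpha> \<longleftrightarrow> (\<forall>\<beta><\<alpha>. \<exists>\<gamma>\<in>C. \<beta> < \<gamma> \<and> \<gamma> < \<alpha>)"
  by (subst osup_eq_iff) auto

lemma acc_pts_iff:
  "(\<alpha>::'k) \<in> acc_pts C \<longleftrightarrow>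
    \<alpha> \<in> C \<and> ord_zero < \<alpha> \<and> (\<forall>\<beta><\<alpha>. \<exists>\<gamma>\<in>C. \<beta> < \<gamma> \<and> \<gamma> < \<alpha>)"
  by (auto simp: acc_pts_def osup_Int_eq_iff)

lemma acc_pts_limit: "(\<alpha>::'k) \<in> acc_pts C \<Longrightarrow> limit_ord \<alpha>"
  by (auto simp: acc_pts_iff limit_ord_def)

lemma closed_subset_iff:
  "closed_subset X C \<longleftrightarrow> C \<subseteq> X \<and>
    (\<forall>\<gamma>::'k \<in> X. ord_zero < \<gamma> \<and> (\<forall>\<beta><\<gamma>. \<exists>\<delta>\<in>C. \<beta> < \<delta> \<and> \<delta> < \<gamma>) \<longrightarrow> \<gamma> \<in> C)"
  by (simp add: closed_subset_def osup_Int_eq_iff)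

text \<open>A set without a maximum accumulates at its least strict upper bound.\<close>

lemma closed_subset_max_or_cofinal:
  assumes "closed_subset {..<\<alpha>} C" "\<delta> \<in> C" "\<gamma> \<in> C" "\<gamma> < (\<delta>::'k)"
  obtains \<delta>' where "\<delta>' \<in> C" "\<gamma> \<le> \<delta>'" "\<delta>' < \<delta>" "\<And>\<beta>. \<beta> \<in> C \<Longrightarrow> \<beta> < \<delta> \<Longrightarrow> \<beta> \<le> \<delta>'"
  | "\<And>\<beta>. \<beta> < \<delta> \<Longrightarrow> \<exists>\<delta>'\<in>C. \<beta> < \<delta>' \<and> \<gamma> \<le> \<delta>' \<and> \<delta>' < \<delta>"
proof (cases "\<exists>\<beta><\<delta>. \<forall>\<delta>'\<in>C. \<delta>' < \<delta> \<longrightarrow> \<delta>' \<le> \<beta>")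
  case True
  define \<sigma> where "\<sigma> = (LEAST \<beta>. \<forall>\<delta>'\<in>C. \<delta>' < \<delta> \<longrightarrow> \<delta>' \<le> \<beta>)"
  have ub: "\<forall>\<delta>'\<in>C. \<delta>' < \<delta> \<longrightarrow> \<delta>' \<le> \<sigma>"
    unfolding \<sigma>_def using True by (intro LeastI_ex[of "\<lambda>\<beta>. \<forall>\<delta>'\<in>C. \<delta>' < \<delta> \<longrightarrow> \<delta>' \<le> \<beta>"]) blast
  have least: "\<exists>\<delta>'\<in>C. \<delta>' < \<delta> \<and> \<beta> < \<delta>'" if "\<beta> < \<sigma>" for \<beta>
    using not_less_Least[OF that[unfolded \<sigma>_def]] by (auto simp: not_le)
  have "\<sigma> < \<delta>"
  proof -
    obtain \<beta> where "\<beta> < \<delta>" "\<forall>\<delta>'\<in>C. \<delta>' < \<delta> \<longrightarrow> \<delta>' \<le> \<beta>" using True by blast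
    moreover from this(2) have "\<sigma> \<le> \<beta>" unfolding \<sigma>_def by (rule Least_le)
    ultimately show ?thesis by simp
  qed
  have "\<sigma> \<in> C"
  proof (rule ccontr)
    assume n: "\<sigma> \<notin> C"
    have "\<gamma> \<le> \<sigma>" using ub assms(3,4) by blast
    with n assms(3) have "\<gamma> < \<sigma>" by (metis order_less_le)
    moreover have "\<exists>\<delta>'\<in>C. \<beta> < \<delta>' \<and> \<delta>' < \<sigma>" if "\<beta> < \<sigma>" for \<beta>
    proof -
      obtain \<delta>' where d: "\<delta>' \<in> C" "\<delta>' < \<delta>" "\<beta> < \<delta>'" using least \<open>\<beta> < \<sigma>\<close> by blast
      then have "\<delta>' \<le> \<sigma>" "\<delta>' \<noteq> \<sigma>" using ub n by auto
      with d show ?thesis by (metis order_less_le)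
    qed
    moreover have "\<sigma> \<in> {..<\<alpha>}"
      using \<open>\<sigma> < \<delta>\<close> assms(1,2) by (auto simp: closed_subset_def)
    ultimately show False
      using n assms(1) ord_zero_le[of \<gamma>] by (auto simp: closed_subset_iff)
  qed
  then show ?thesis
    using that(1) ub \<open>\<sigma> < \<delta>\<close> assms(3,4) by blast
next
  case False
  have "\<exists>\<delta>'\<in>C. \<beta> < \<delta>' \<and> \<gamma> \<le> \<delta>' \<and> \<delta>' < \<delta>" if "\<beta> < \<delta>" for \<beta>
  proof -
    have "max \<beta> \<gamma> < \<delta>" using that assms(4) by simp
    then obtain \<delta>' where "\<delta>' \<in> C" "\<delta>' < \<delta>" "max \<beta> \<gamma> < \<delta>'"
      using False by (meson not_le)
    then show ?thesis by (auto intro!: bexI[of _ \<delta>'])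
  qed
  then show ?thesis using that(2) by blast
qed

section \<open>Clubs, stationary sets and uncountable cofinality\<close>

text \<open>A limit of closure points of \<open>f\<close> is again one. Beyond a given \<alpha>, a
  closure point is reached by \<omega> iterations, which stay bounded because \<kappa> is regular
  and uncountable.\<close>

lemma club_closure_points:
  fixes f :: "'k \<Rightarrow> 'k"
  shows "club {\<beta>. limit_ord \<beta> \<and> (\<forall>\<gamma><\<beta>. f \<gamma> < \<beta>)}" (is "club ?E")
  unfolding club_def
proof
  show "closed_subset UNIV ?E"
    unfolding closed_subset_iff
  proof (intro conjI ballI impI)
    fix \<gamma> :: 'k
    assume A: "ord_zero < \<gamma> \<and> (\<forall>\<beta><\<gamma>. \<exists>\<delta>\<in>?E. \<beta> < \<delta> \<and> \<delta> < \<gamma>)"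
    then have "limit_ord \<gamma>" by (auto simp: limit_ord_def)
    moreover have "f \<beta> < \<gamma>" if "\<beta> < \<gamma>" for \<beta>
    proof -
      obtain \<delta> where "\<delta> \<in> ?E" "\<beta> < \<delta>" "\<delta> < \<gamma>" using A \<open>\<beta> < \<gamma>\<close> by meson
      then show ?thesis by (auto intro: less_trans)
    qed
    ultimately show "\<gamma> \<in> ?E" by blast
  qed simp
  show "cofinal_kappa ?E"
    unfolding cofinal_kappa_def
  proof
    fix \<alpha> :: 'k
    \<comment> \<open>The bound has to serve the whole initial segment up to \<gamma>, since closure
      is later tested at all smaller ordinals and not just at the iterates.\<close>
    have "\<exists>\<beta>. \<forall>\<delta>\<le>\<gamma>. f \<delta> < \<beta> \<and> \<delta> < \<beta>" for \<gamma>
    proof -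
      have "|f ` {..<osuc \<gamma>} \<union> {..<osuc \<gamma>}| <o (kappa :: 'k rel)"
        by (intro small_Un small_image small_lessThan)
      from small_bounded[OF this] show ?thesis
        by (auto simp: lessThan_osuc)
    qed
    then obtain h where h: "\<And>\<gamma> \<delta>. \<delta> \<le> \<gamma> \<Longrightarrow> f \<delta> < h \<gamma> \<and> \<delta> < h \<gamma>" by metis
    define g where "g n = (h ^^ n) \<alpha>" for n
    have gSuc: "g (Suc n) = h (g n)" for n by (simp add: g_def)
    obtain \<beta>0 where \<beta>0: "\<forall>n. g n < \<beta>0" using small_bounded[OF small_countable[of g]] by auto
    \<comment> \<open>As the least strict bound of the iterates, \<beta> has some \<open>g n\<close>
      at or above each smaller ordinal.\<close>
    define \<beta> where "\<beta> = (LEAST \<beta>. \<forall>n. g n < \<beta>)"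
    have g\<beta>: "g n < \<beta>" for n
      unfolding \<beta>_def using LeastI[of "\<lambda>\<beta>. \<forall>n. g n < \<beta>", OF \<beta>0] by blast
    have g_ex: "\<exists>n. \<gamma> \<le> g n" if "\<gamma> < \<beta>" for \<gamma>
      using not_less_Least[OF that[unfolded \<beta>_def]] by (auto simp: not_less)
    have "f \<gamma> < \<beta> \<and> (\<exists>\<delta><\<beta>. \<gamma> < \<delta>)" if "\<gamma> < \<beta>" for \<gamma>
    proof -
      obtain n where "\<gamma> \<le> g n" using g_ex \<open>\<gamma> < \<beta>\<close> by blast
      then have "f \<gamma> < g (Suc n) \<and> \<gamma> < g (Suc n)" using h gSuc by simp
      then show ?thesis using g\<beta> less_trans by blast
    qed
    moreover have "\<alpha> < \<beta>" using g\<beta>[of 0] by (simp add: g_def)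
    ultimately have "\<beta> \<in> ?E" "\<alpha> \<le> \<beta>"
      using ord_zero_le[of \<alpha>] by (auto simp: limit_ord_def)
    then show "\<exists>\<beta>\<in>?E. \<alpha> \<le> \<beta>" by blast
  qed
qed

text \<open>Taking the maximum of \<open>f\<close> with the constant \<alpha> forces the closure
  point above \<alpha>, because \<open>ord_zero\<close> lies below it.\<close>

lemma stationary_closure_point:
  fixes f :: "'k \<Rightarrow> 'k"
  assumes "stationary S"
  obtains \<beta> where "\<beta> \<in> S" "limit_ord \<beta>" "\<And>\<gamma>. \<gamma> < \<beta> \<Longrightarrow> f \<gamma> < \<beta>" "\<alpha> < \<beta>"
proof -
  obtain \<beta> where \<beta>: "\<beta> \<in> S" "limit_ord \<beta>" "\<forall>\<gamma><\<beta>. max (f \<gamma>) \<alpha> < \<beta>"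
    using assms club_closure_points[of "\<lambda>\<gamma>. max (f \<gamma>) \<alpha>"] unfolding stationary_def by blast
  then have "ord_zero < \<beta>" by (simp add: limit_ord_def)
  with \<beta> show thesis using that by fastforce
qed

lemma ex_limit_ord: "\<exists>\<alpha>::'k. limit_ord \<alpha>"
  using club_closure_points[of id] by (auto simp: club_def cofinal_kappa_def)

text \<open>An unbounded countable subset of \<open>\<alpha>\<close> would be the image of \<open>\<omega>\<close>, so \<open>cf \<alpha> \<le> \<omega>\<close>.\<close>

lemma countable_bounded_below:
  fixes s :: "nat \<Rightarrow> 'k"
  assumes cf: "\<alpha> \<in> E_gt_omega" and s: "\<And>n. s n < \<alpha>"
  shows "\<exists>\<beta><\<alpha>. \<forall>n. s n < \<beta>"
proof (rule ccontr)
  assume "\<not> ?thesis"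
  then have unb: "\<exists>n. \<beta> \<le> s n" if "\<beta> < \<alpha>" for \<beta> using that by (meson not_less)
  define h where "h n = (osuc ^^ n) ord_zero" for n
  have lim: "limit_ord (ord_omega :: 'k)"
    unfolding ord_omega_def using ex_limit_ord by (rule LeastI_ex)
  have h_less: "h n < ord_omega" for n
    by (induction n) (use lim osuc_less_limit in \<open>auto simp: h_def limit_ord_def\<close>)
  have "h n < h (Suc n)" for n by (simp add: h_def less_osuc)
  then have inj: "inj h"
    by (intro strict_mono_imp_inj_on) (simp add: strict_mono_Suc_iff)
  \<comment> \<open>The sequence \<open>s\<close> is transported along the finite ordinals
    \<open>h n\<close>. Off the range of \<open>h\<close> the number \<open>inv h \<delta>\<close>
    is arbitrary, and the value is still below \<alpha>.\<close>
  define f where "f \<delta> = s (inv h \<delta>)" for \<delta>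
  have "f ` {..<ord_omega} \<subseteq> {..<\<alpha>}" using s by (auto simp: f_def)
  moreover have "\<exists>\<delta>. \<delta> < ord_omega \<and> \<gamma> \<le> f \<delta>" if "\<gamma> < \<alpha>" for \<gamma>
    using unb[OF that] h_less inj by (metis f_def inv_f_f)
  ultimately have "cf \<alpha> \<le> ord_omega"
    unfolding cf_def by (intro Least_le) blast
  with cf show False by (simp add: E_gt_omega_def)
qed

text \<open>Interleaving: moving alternately into \<open>C\<close> and into \<open>D\<close> gives
  an increasing \<omega>-sequence. Its supremum \<sigma> is below \<alpha> by uncountable
  cofinality, is a limit of both sets, and so lies in both by closedness.\<close>

lemma closed_cofinal_Int:
  fixes C D :: "'k set"
  assumes cf: "\<alpha> \<in> E_gt_omega"
    and C: "closed_subset {..<\<alpha>} C" "\<And>\<beta>. \<beta> < \<alpha> \<Longrightarrow> \<exists>\<gamma>\<in>C. \<beta> < \<gamma>"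
    and D: "closed_subset {..<\<alpha>} D" "\<And>\<beta>. \<beta> < \<alpha> \<Longrightarrow> \<exists>\<gamma>\<in>D. \<beta> < \<gamma>"
    and \<beta>: "\<beta> < \<alpha>"
  shows "\<exists>\<gamma>\<in>C \<inter> D. \<beta> < \<gamma>"
proof -
  have sub: "C \<subseteq> {..<\<alpha>}" "D \<subseteq> {..<\<alpha>}" using C D by (auto simp: closed_subset_def)
  obtain c where c: "\<And>\<gamma>. \<gamma> < \<alpha> \<Longrightarrow> c \<gamma> \<in> C \<and> \<gamma> < c \<gamma>" using C(2) by metis
  obtain d where d: "\<And>\<gamma>. \<gamma> < \<alpha> \<Longrightarrow> d \<gamma> \<in> D \<and> \<gamma> < d \<gamma>" using D(2) by metis
  define s where "s n = ((d \<circ> c) ^^ n) \<beta>" for n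
  have s_less: "s n < \<alpha>" for n
    by (induction n) (use c d sub \<beta> in \<open>auto simp: s_def\<close>)
  have cs: "c (s n) \<in> C" "s n < c (s n)" "c (s n) < \<alpha>" for n using c s_less sub by auto
  have ds: "s (Suc n) \<in> D" "c (s n) < s (Suc n)" for n
    using d[of "c (s n)"] cs by (auto simp: s_def)
  define \<sigma> where "\<sigma> = (LEAST \<sigma>. \<forall>n. s n < \<sigma>)"
  obtain \<sigma>0 where \<sigma>0: "\<sigma>0 < \<alpha>" "\<forall>n. s n < \<sigma>0" using countable_bounded_below[OF cf, of s] s_less by blast
  have "s n < \<sigma>" for n
    unfolding \<sigma>_def using LeastI[of "\<lambda>\<sigma>. \<forall>n. s n < \<sigma>", OF \<sigma>0(2)] by blast
  note s\<sigma> = this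
  have "\<sigma> \<le> \<sigma>0" unfolding \<sigma>_def using \<sigma>0(2) by (rule Least_le)
  then have "\<sigma> < \<alpha>" using \<sigma>0 by simp
  have ex: "\<exists>n. \<gamma> \<le> s n" if "\<gamma> < \<sigma>" for \<gamma>
    using not_less_Least[OF that[unfolded \<sigma>_def]] by (auto simp: not_less)
  have "\<exists>\<delta>\<in>C. \<gamma> < \<delta> \<and> \<delta> < \<sigma>" "\<exists>\<delta>\<in>D. \<gamma> < \<delta> \<and> \<delta> < \<sigma>" if "\<gamma> < \<sigma>" for \<gamma>
  proof -
    obtain n where n: "\<gamma> \<le> s n" using ex \<open>\<gamma> < \<sigma>\<close> by blast
    show "\<exists>\<delta>\<in>C. \<gamma> < \<delta> \<and> \<delta> < \<sigma>"
      using n cs[of n] ds[of n] s\<sigma>[of "Suc n"] by (meson le_less_trans less_trans)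
    show "\<exists>\<delta>\<in>D. \<gamma> < \<delta> \<and> \<delta> < \<sigma>"
      using n cs[of n] ds[of n] s\<sigma>[of "Suc n"] by (meson le_less_trans less_trans)
  qed
  moreover have "\<beta> < \<sigma>" using s\<sigma>[of 0] by (simp add: s_def)
  moreover have "ord_zero < \<sigma>" using \<open>\<beta> < \<sigma>\<close> ord_zero_le[of \<beta>] by simp
  ultimately have "\<sigma> \<in> C" "\<sigma> \<in> D"
    using C(1) D(1) \<open>\<sigma> < \<alpha>\<close> by (auto simp: closed_subset_iff)
  then show ?thesis using \<open>\<beta> < \<sigma>\<close> by blast
qed

end

section \<open>Coding of nodes by ordinals\<close>

text \<open>These sets supply \<kappa> many elements of \<open>H_kappa\<close>, from which all
  values of nodes of the tree are taken.\<close>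

function von_neumann :: "'k::wellorder \<Rightarrow> 'k hset" where
  "von_neumann \<alpha> = (SOME x. \<forall>z. hmem z x \<longleftrightarrow> z \<in> von_neumann ` {..<\<alpha>})"
  by pat_completeness auto
termination by (relation "{(x, y). x < y}") (auto simp: wf)

declare von_neumann.simps [simp del]

lemma hmem_von_neumann: "hmem z (von_neumann \<alpha>) \<longleftrightarrow> z \<in> von_neumann ` {..<\<alpha>}"
proof -
  have "|von_neumann ` {..<\<alpha>}| \<le>o |UNIV :: 'a set|"
    by (rule ordLeq_transitive[OF card_of_image card_of_mono1]) simp
  then have "\<exists>x. \<forall>z. hmem z x \<longleftrightarrow> z \<in> von_neumann ` {..<\<alpha>}"
    by (rule hset_comprehension)
  from someI_ex[OF this] show ?thesis
    unfolding von_neumann.simps[of \<alpha>] by blast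
qed

text \<open>A smaller ordinal is an element of a larger one, and well-founded membership is
  irreflexive.\<close>

lemma inj_von_neumann: "inj von_neumann"
proof (rule linorder_injI)
  fix \<alpha> \<beta> :: "'a::wellorder"
  assume "\<alpha> < \<beta>"
  then have "hmem (von_neumann \<alpha>) (von_neumann \<beta>)" by (simp add: hmem_von_neumann)
  then show "von_neumann \<alpha> \<noteq> von_neumann \<beta>"
    using wfp_imp_irreflp[OF hset_wf] by (metis irreflpD)
qed

text \<open>Descending along \<open>hmem\<close> from such a set leads only to the sets of smaller
  ordinals. There are fewer than \<kappa> of these, which yields membership in
  \<open>H_kappa\<close>.\<close>

lemma trcl_von_neumann: "trcl (von_neumann \<alpha>) \<subseteq> von_neumann ` {..<\<alpha>}"
proof -
  have "y \<in> von_neumann ` {..<\<alpha>}" if "hmem\<^sup>+\<^sup>+ y x" "x = von_neumann \<alpha>" for x y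
    using that
  proof (induction rule: converse_tranclp_induct)
    case (base y)
    then show ?case by (simp add: hmem_von_neumann)
  next
    case (step y z)
    then obtain \<beta> where "z = von_neumann \<beta>" "\<beta> < \<alpha>" by auto
    with step show ?case by (auto simp: hmem_von_neumann)
  qed
  then show ?thesis by (auto simp: trcl_def)
qed

context regular_uncountable
begin

lemma von_neumann_H_kappa: "von_neumann (\<alpha>::'k) \<in> H_kappa"
  using small_mono[OF trcl_von_neumann small_image[OF small_lessThan]]
  by (simp add: H_kappa_def)

text \<open>An ambient set for the tree. Its elements are numbered by ordinals, so that a diamond
  sequence, which guesses sets of ordinals, can guess sets of nodes.\<close>

definition coded_nodes :: "'k node set" where
  "coded_nodes = {t. (\<exists>\<alpha>. dom t = {..<\<alpha>}) \<and> ran t \<subseteq> range von_neumann}"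

text \<open>
  A diamond sequence enumerates all bounded subsets of \<open>\<kappa>\<close>, so there are only \<open>\<kappa>\<close> many nodes.
\<close>

lemma diamond_coding:
  fixes S :: "'k \<Rightarrow> 'k set"
  assumes S: "\<And>A. stationary {\<alpha>. A \<inter> {..<\<alpha>} = S \<alpha>}"
  obtains e :: "'k node \<Rightarrow> 'k" where "inj_on e coded_nodes"
proof -
  have "|UNIV \<times> UNIV :: ('k \<times> 'k) set| \<le>o |UNIV :: 'k set|"
    using card_of_Times_same_infinite[OF infinite_UNIV_kappa] ordIso_iff_ordLeq by blast
  then obtain p :: "'k \<times> 'k \<Rightarrow> 'k" where p: "inj p"
    using card_of_ordLeq[of "UNIV \<times> UNIV" UNIV] by (metis UNIV_Times_UNIV)
  \<comment> \<open>The pairing \<open>p\<close> turns the graph of a node into a set of ordinals.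
    This set is bounded, as a node has fewer than \<kappa> places.\<close>
  define G where "G t = {(x, y). t x = Some (von_neumann y)}" for t :: "'k node"
  have "\<exists>\<alpha>. S \<alpha> = p ` G t" if t: "t \<in> coded_nodes" for t
  proof -
    obtain \<alpha> where \<alpha>: "dom t = {..<\<alpha>}" using t by (auto simp: coded_nodes_def)
    have "G t \<subseteq> (\<lambda>x. (x, inv von_neumann (the (t x)))) ` {..<\<alpha>}"
    proof clarify
      fix x y assume "(x, y) \<in> G t"
      then have "t x = Some (von_neumann y)" by (simp add: G_def)
      moreover from this have "x \<in> {..<\<alpha>}" using \<alpha> by blast
      ultimately show "(x, y) \<in> (\<lambda>x. (x, inv von_neumann (the (t x)))) ` {..<\<alpha>}"
        by (intro image_eqI[of _ _ x]) (simp_all add: inj_von_neumann)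
    qed
    then have "|p ` G t| <o (kappa :: 'k rel)"
      by (intro small_image small_mono[OF _ small_image[OF small_lessThan]])
    then obtain \<beta> where "\<forall>x\<in>p ` G t. x < \<beta>" using small_bounded by blast
    \<comment> \<open>Correct guesses occur above every bound. Past \<beta> the intersection with
      \<open>{..<\<alpha>'}\<close> cuts nothing off, and the guess is the coded graph
      itself.\<close>
    moreover obtain \<alpha>' where "p ` G t \<inter> {..<\<alpha>'} = S \<alpha>'" "\<beta> < \<alpha>'"
      by (rule stationary_closure_point[OF S[of "p ` G t"], of id \<beta>]) simp
    moreover from calculation have "p ` G t \<subseteq> {..<\<alpha>'}" by (meson lessThan_iff less_trans subsetI)
    ultimately show ?thesis by (metis inf.absorb1)
  qed
  then obtain e where e: "\<And>t. t \<in> coded_nodes \<Longrightarrow> S (e t) = p ` G t" by metis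
  have "inj_on e coded_nodes"
  proof (rule inj_onI)
    fix s t assume st: "s \<in> coded_nodes" "t \<in> coded_nodes" "e s = e t"
    then have "p ` G s = p ` G t" using e by metis
    then have G: "G s = G t" using p by (simp add: inj_image_eq_iff)
    have val: "u x = None \<or> (\<exists>y. u x = Some (von_neumann y))" if "u \<in> coded_nodes" for u x
      using that ranI[of u x] by (cases "u x") (auto simp: coded_nodes_def)
    show "s = t"
    proof
      fix x
      have "s x = Some (von_neumann y) \<longleftrightarrow> t x = Some (von_neumann y)" for y
        using G by (auto simp: G_def set_eq_iff)
      then show "s x = t x" using val[OF st(1), of x] val[OF st(2), of x] by metis
    qed
  qed
  then show thesis using that by blast
qed

end

section \<open>Construction of the tree\<close>

lemma restrict_eq_iff: "t |` A = s |` A \<longleftrightarrow> (\<forall>x\<in>A. t x = s x)"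
  by (auto simp: fun_eq_iff restrict_map_def)

lemma map_le_iff_restrict: "s \<subseteq>\<^sub>m t \<longleftrightarrow> t |` dom s = s"
  unfolding map_le_def fun_eq_iff restrict_map_def by (metis domIff)

lemma restrict_superset: "dom t \<subseteq> A \<Longrightarrow> t |` A = t"
  unfolding fun_eq_iff restrict_map_def by (metis domIff subsetD)

section \<open>A single step of the climb\<close>

definition consecutive :: "'k::wellorder set \<Rightarrow> 'k \<Rightarrow> 'k \<Rightarrow> bool" where
  "consecutive C \<delta> \<delta>' \<longleftrightarrow> \<delta> \<in> C \<and> \<delta>' \<in> C \<and> \<delta> < \<delta>' \<and> (\<forall>\<beta>\<in>C. \<not> (\<delta> < \<beta> \<and> \<beta> < \<delta>'))"

text \<open>The choice depends on the three arguments alone. This makes a climb determined by its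
  start and its labels, see \<open>follows_unique\<close>.\<close>

definition pick :: "'k node set \<Rightarrow> 'k node set \<Rightarrow> 'k node \<Rightarrow> 'k node" where
  "pick X \<Omega> z =
    (if \<exists>t\<in>X. z \<subseteq>\<^sub>m t \<and> (\<exists>d\<in>\<Omega>. d \<subseteq>\<^sub>m t)
     then SOME t. t \<in> X \<and> z \<subseteq>\<^sub>m t \<and> (\<exists>d\<in>\<Omega>. d \<subseteq>\<^sub>m t)
     else SOME t. t \<in> X \<and> z \<subseteq>\<^sub>m t)"

lemma pick_extends:
  assumes "t \<in> X" "z \<subseteq>\<^sub>m t"
  shows "pick X \<Omega> z \<in> X" "z \<subseteq>\<^sub>m pick X \<Omega> z"
proof -
  have "pick X \<Omega> z \<in> X \<and> z \<subseteq>\<^sub>m pick X \<Omega> z"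
  proof (cases "\<exists>t\<in>X. z \<subseteq>\<^sub>m t \<and> (\<exists>d\<in>\<Omega>. d \<subseteq>\<^sub>m t)")
    case True
    then have "\<exists>t. t \<in> X \<and> z \<subseteq>\<^sub>m t \<and> (\<exists>d\<in>\<Omega>. d \<subseteq>\<^sub>m t)" by blast
    from someI_ex[OF this] show ?thesis using True by (simp add: pick_def)
  next
    case False
    have "\<exists>t. t \<in> X \<and> z \<subseteq>\<^sub>m t" using assms by blast
    from someI_ex[OF this] show ?thesis unfolding pick_def if_not_P[OF False] .
  qed
  then show "pick X \<Omega> z \<in> X" "z \<subseteq>\<^sub>m pick X \<Omega> z" by auto
qed

lemma pick_seals:
  assumes "t \<in> X" "z \<subseteq>\<^sub>m t" "d \<in> \<Omega>" "d \<subseteq>\<^sub>m t"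
  shows "\<exists>d\<in>\<Omega>. d \<subseteq>\<^sub>m pick X \<Omega> z"
proof -
  have ex: "\<exists>t. t \<in> X \<and> z \<subseteq>\<^sub>m t \<and> (\<exists>d\<in>\<Omega>. d \<subseteq>\<^sub>m t)" using assms by blast
  then have "pick X \<Omega> z = (SOME t. t \<in> X \<and> z \<subseteq>\<^sub>m t \<and> (\<exists>d\<in>\<Omega>. d \<subseteq>\<^sub>m t))"
    by (auto simp: pick_def)
  with someI_ex[OF ex] show ?thesis by simp
qed

text \<open>The data common to both cases. The ordinals \<open>e t\<close> let the diamond sequence
  speak of nodes, and \<open>g \<alpha>\<close> numbers level \<alpha> of \<open>K\<close>, so that
  its nodes can be written into the tree as labels.\<close>

locale souslin_construction = regular_uncountable ty
  for ty :: "'k::wellorder itself" +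
  fixes K :: "'k node set" and \<C> :: "'k \<Rightarrow> 'k set set" and S :: "'k \<Rightarrow> 'k set"
    and e :: "'k node \<Rightarrow> 'k" and g :: "'k \<Rightarrow> 'k node \<Rightarrow> 'k"
  assumes tree_K: "streamlined_tree K"
    and \<C>_nonempty: "\<C> \<alpha> \<noteq> {}"
    and \<C>_small: "|\<C> \<alpha>| <o (kappa :: 'k rel)"
    and \<C>_closed: "C \<in> \<C> \<alpha> \<Longrightarrow> closed_subset {..<\<alpha>} C"
    and \<C>_osup: "C \<in> \<C> \<alpha> \<Longrightarrow> osup C = osup {..<\<alpha>}"
    and \<C>_coherent: "C \<in> \<C> \<alpha> \<Longrightarrow> \<alpha>' \<in> acc_pts C \<Longrightarrow> \<exists>D\<in>\<C> \<alpha>'. D \<sqsubseteq>\<^sub>* C"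
    and \<C>_guess: "cofinal_kappa B \<Longrightarrow> stationary {\<alpha>. \<forall>C\<in>\<C> \<alpha>. osup (nacc_pts C \<inter> B) = \<alpha>}"
    and diamond_S: "stationary {\<alpha>. A \<inter> {..<\<alpha>} = S \<alpha>}"
    and inj_e: "inj_on e coded_nodes"
    and inj_g: "inj_on (g \<alpha>) (level K \<alpha>)"
begin

lemma \<C>_subset: "C \<in> \<C> \<alpha> \<Longrightarrow> C \<subseteq> {..<\<alpha>}"
  using \<C>_closed by (auto simp: closed_subset_def)

lemma \<C>_cofinal:
  assumes "C \<in> \<C> \<alpha>" "limit_ord \<alpha>" "\<beta> < \<alpha>"
  shows "\<exists>\<gamma>\<in>C. \<beta> < \<gamma>"
  using assms osup_eq_iff[OF \<C>_subset[OF assms(1)]] \<C>_osup osup_lessThan_limit by metis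

section \<open>Labels, guesses and the recursion for the levels\<close>

text \<open>Only the restriction of \<eta> to \<alpha> enters. Labels therefore make sense along the
  limit of a vanishing branch of \<open>K\<close>, which is itself no node of
  \<open>K\<close>.\<close>

definition lab :: "'k \<Rightarrow> 'k node \<Rightarrow> 'k hset" where
  "lab \<alpha> \<eta> = von_neumann (g \<alpha> (\<eta> |` {..<\<alpha>}))"

definition labels :: "'k \<Rightarrow> 'k hset set" where
  "labels \<alpha> = (\<lambda>\<eta>. von_neumann (g \<alpha> \<eta>)) ` level K \<alpha> \<union>
     {von_neumann ord_zero, von_neumann (osuc ord_zero)}"

definition guess :: "'k \<Rightarrow> 'k node set" where
  "guess \<beta> = {d\<in>coded_nodes. e d \<in> S \<beta>}"

text \<open>The limit clause keeps only the results of climbs along some \<open>C\<close> from some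
  \<gamma> on. Bounding \<beta> and \<delta>' by \<open>{..<\<alpha>}\<close> shows the termination
  proof that only lower levels are called; \<open>Lev_iff\<close> is the working form.\<close>

function Lev :: "'k \<Rightarrow> 'k node set" where
  "Lev \<alpha> = {t. dom t = {..<\<alpha>} \<and> (\<forall>\<beta><\<alpha>. t \<beta> \<in> Some ` labels \<beta>) \<and>
     (\<forall>\<beta>\<in>{..<\<alpha>}. t |` {..<\<beta>} \<in> Lev \<beta>) \<and>
     (limit_ord \<alpha> \<longrightarrow> (\<exists>C\<in>\<C> \<alpha>. \<exists>\<eta>\<in>level K \<alpha>. \<exists>\<gamma>\<in>C. \<forall>\<delta>\<in>C. \<gamma> \<le> \<delta> \<longrightarrow>
        t \<delta> = Some (lab \<delta> \<eta>) \<and>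
        (\<forall>\<delta>'\<in>C \<inter> {..<\<alpha>}. consecutive C \<delta> \<delta>' \<longrightarrow>
           t |` {..<\<delta>'} = pick (Lev \<delta>') (guess \<delta>') (t |` {..\<delta>}))))}"
  by pat_completeness auto
termination by (relation "{(x, y). x < y}") (auto simp: wf)

declare Lev.simps [simp del]

text \<open>The limit clause of \<open>Lev\<close> stopped at \<beta>, so that climbs can be built
  by induction. The case \<delta>' = \<beta> is included because the condition at \<delta>' concerns
  only values below \<delta>'.\<close>

definition follows :: "'k set \<Rightarrow> 'k node \<Rightarrow> 'k \<Rightarrow> 'k \<Rightarrow> 'k node \<Rightarrow> bool" where
  "follows C \<eta> \<gamma> \<beta> t \<longleftrightarrow> (\<forall>\<delta>\<in>C. \<gamma> \<le> \<delta> \<longrightarrow> \<delta> < \<beta> \<longrightarrow>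
     t \<delta> = Some (lab \<delta> \<eta>) \<and>
     (\<forall>\<delta>'\<in>C. \<delta>' \<le> \<beta> \<longrightarrow> consecutive C \<delta> \<delta>' \<longrightarrow>
        t |` {..<\<delta>'} = pick (Lev \<delta>') (guess \<delta>') (t |` {..\<delta>})))"

lemma Lev_iff:
  "t \<in> Lev \<alpha> \<longleftrightarrow> dom t = {..<\<alpha>} \<and> (\<forall>\<beta><\<alpha>. t \<beta> \<in> Some ` labels \<beta>) \<and>
     (\<forall>\<beta><\<alpha>. t |` {..<\<beta>} \<in> Lev \<beta>) \<and>
     (limit_ord \<alpha> \<longrightarrow> (\<exists>C\<in>\<C> \<alpha>. \<exists>\<eta>\<in>level K \<alpha>. \<exists>\<gamma>\<in>C. follows C \<eta> \<gamma> \<alpha> t))"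
proof -
  have "(\<forall>\<delta>\<in>C. \<gamma> \<le> \<delta> \<longrightarrow> t \<delta> = Some (lab \<delta> \<eta>) \<and>
        (\<forall>\<delta>'\<in>C \<inter> {..<\<alpha>}. consecutive C \<delta> \<delta>' \<longrightarrow>
           t |` {..<\<delta>'} = pick (Lev \<delta>') (guess \<delta>') (t |` {..\<delta>}))) \<longleftrightarrow> follows C \<eta> \<gamma> \<alpha> t"
    if "C \<in> \<C> \<alpha>" for C \<eta> \<gamma>
    using \<C>_subset[OF that] unfolding follows_def by (auto dest: subsetD less_imp_le)
  note eq = this
  show ?thesis
    by (subst Lev.simps) (simp add: eq cong: bex_cong; blast)
qed

lemma Lev_dom: "t \<in> Lev \<alpha> \<Longrightarrow> dom t = {..<\<alpha>}"
  by (drule Lev_iff[THEN iffD1]) blast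

lemma Lev_restrict: "t \<in> Lev \<alpha> \<Longrightarrow> \<beta> \<le> \<alpha> \<Longrightarrow> t |` {..<\<beta>} \<in> Lev \<beta>"
  using Lev_iff[of t \<alpha>] by (cases "\<beta> = \<alpha>") (auto simp: restrict_superset)

lemma Lev_extends_iff: "s \<in> Lev \<beta> \<Longrightarrow> s \<subseteq>\<^sub>m t \<longleftrightarrow> t |` {..<\<beta>} = s"
  by (simp add: map_le_iff_restrict Lev_dom)

lemma Lev_zero: "Map.empty \<in> Lev ord_zero"
  unfolding Lev_iff[of _ ord_zero] by (auto simp: limit_ord_def not_less_ord_zero)

lemma Lev_update:
  assumes t: "t \<in> Lev \<gamma>" and c: "c \<in> labels \<gamma>"
  shows "t(\<gamma> \<mapsto> c) \<in> Lev (osuc \<gamma>)"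
proof -
  have res: "(t(\<gamma> \<mapsto> c)) |` {..<\<beta>} = t |` {..<\<beta>}" if "\<beta> \<le> \<gamma>" for \<beta>
    unfolding restrict_eq_iff using that by (metis fun_upd_other lessThan_iff leD)
  show ?thesis
    unfolding Lev_iff[of _ "osuc \<gamma>"]
  proof (intro conjI allI impI)
    show "dom (t(\<gamma> \<mapsto> c)) = {..<osuc \<gamma>}"
      using Lev_dom[OF t] by (auto simp: less_osuc_iff)
    fix \<beta> assume "\<beta> < osuc \<gamma>"
    then have "\<beta> \<le> \<gamma>" by (simp add: less_osuc_iff)
    then show "(t(\<gamma> \<mapsto> c)) |` {..<\<beta>} \<in> Lev \<beta>" using res Lev_restrict[OF t] by simp
    show "(t(\<gamma> \<mapsto> c)) \<beta> \<in> Some ` labels \<beta>"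
      using \<open>\<beta> \<le> \<gamma>\<close> c t by (cases "\<beta> = \<gamma>") (auto simp: Lev_iff[of t])
  qed (use not_limit_osuc in blast)
qed

text \<open>The label condition at \<gamma> is inherited from the restriction to
  \<open>osuc \<gamma>\<close>, which is still below the limit \<beta>.\<close>

lemma Lev_limitI:
  assumes lim: "limit_ord \<beta>" and t: "dom t = {..<\<beta>}" "\<And>\<gamma>. \<gamma> < \<beta> \<Longrightarrow> t |` {..<\<gamma>} \<in> Lev \<gamma>"
    and "C \<in> \<C> \<beta>" "\<eta> \<in> level K \<beta>" "\<gamma> \<in> C" "follows C \<eta> \<gamma> \<beta> t"
  shows "t \<in> Lev \<beta>"
proof -
  have "t \<gamma> \<in> Some ` labels \<gamma>" if "\<gamma> < \<beta>" for \<gamma>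
  proof -
    have "t |` {..<osuc \<gamma>} \<in> Lev (osuc \<gamma>)" using t(2) osuc_less_limit[OF lim that] by blast
    then show ?thesis using less_osuc[of \<gamma>] unfolding Lev_iff[of _ "osuc \<gamma>"]
      by (metis lessThan_iff restrict_in)
  qed
  then show ?thesis unfolding Lev_iff[of t] using assms by blast
qed

section \<open>Climbs along a closed set\<close>

lemma follows_cong:
  assumes "\<And>x. x < \<beta> \<Longrightarrow> t x = t' x"
  shows "follows C \<eta> \<gamma> \<beta> t \<longleftrightarrow> follows C \<eta> \<gamma> \<beta> t'"
proof -
  have "t |` {..<\<delta>'} = t' |` {..<\<delta>'}" if "\<delta>' \<le> \<beta>" for \<delta>'
    using assms that by (auto simp: restrict_eq_iff)
  moreover have "t |` {..\<delta>} = t' |` {..\<delta>}" if "\<delta> < \<beta>" for \<delta>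
    using assms that by (auto simp: restrict_eq_iff)
  ultimately show ?thesis
    unfolding follows_def using assms by (auto cong: ball_cong)
qed

lemma follows_mono: "follows C \<eta> \<gamma> \<beta> t \<Longrightarrow> \<beta>' \<le> \<beta> \<Longrightarrow> follows C \<eta> \<gamma> \<beta>' t"
  unfolding follows_def by (meson order.trans order.strict_trans2)

text \<open>Each condition for \<sigma> already occurs at a point of \<open>C\<close> below
  \<sigma>: a point of \<open>C\<close> strictly between \<delta> and \<sigma> also bounds the
  successor of \<delta> in \<open>C\<close>.\<close>

lemma follows_limit:
  assumes "\<And>\<beta>. \<beta> < \<sigma> \<Longrightarrow> \<exists>\<delta>\<in>C. \<beta> < \<delta> \<and> \<gamma> \<le> \<delta> \<and> \<delta> < \<sigma>"
    and "\<And>\<delta>. \<delta> \<in> C \<Longrightarrow> \<gamma> \<le> \<delta> \<Longrightarrow> \<delta> < \<sigma> \<Longrightarrow> follows C \<eta> \<gamma> \<delta> t"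
  shows "follows C \<eta> \<gamma> \<sigma> t"
  unfolding follows_def
proof (intro ballI impI conjI)
  fix \<delta> assume \<delta>: "\<delta> \<in> C" "\<gamma> \<le> \<delta>" "\<delta> < \<sigma>"
  then obtain \<delta>1 where "\<delta>1 \<in> C" "\<delta> < \<delta>1" "\<gamma> \<le> \<delta>1" "\<delta>1 < \<sigma>" using assms(1) by blast
  note \<delta>1 = this
  then have f: "follows C \<eta> \<gamma> \<delta>1 t" using assms(2) by blast
  then show "t \<delta> = Some (lab \<delta> \<eta>)" using \<delta> \<delta>1 by (auto simp: follows_def)
  fix \<delta>' assume "\<delta>' \<in> C" "\<delta>' \<le> \<sigma>" "consecutive C \<delta> \<delta>'"
  moreover from this have "\<delta>' \<le> \<delta>1" using \<delta>1 by (auto simp: consecutive_def not_less)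
  ultimately show "t |` {..<\<delta>'} = pick (Lev \<delta>') (guess \<delta>') (t |` {..\<delta>})"
    using f \<delta> \<delta>1 by (auto simp: follows_def)
qed

text \<open>Induction along \<open>C\<close>. If \<delta> has a predecessor in \<open>C\<close>, the
  values below \<delta> are given by \<open>pick\<close> from values already known to agree; if
  \<delta> is a limit of \<open>C\<close>, agreement is inherited. This makes partial climbs
  coherent and also limits the number of nodes at limit levels.\<close>

lemma follows_unique:
  assumes C: "closed_subset {..<\<alpha>} C" and \<gamma>: "\<gamma> \<in> C"
    and t: "follows C \<eta> \<gamma> \<beta> t" "follows C \<eta> \<gamma> \<beta> t'"
    and eq: "\<And>x. x < \<gamma> \<Longrightarrow> t x = t' x"
  shows "\<delta> \<in> C \<Longrightarrow> \<gamma> \<le> \<delta> \<Longrightarrow> \<delta> \<le> \<beta> \<Longrightarrow> x < \<delta> \<Longrightarrow> t x = t' x"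
proof (induction \<delta> arbitrary: x rule: less_induct)
  case (less \<delta>)
  show ?case
  proof (cases "\<delta> = \<gamma>")
    case True
    then show ?thesis using eq less.prems by simp
  next
    case False
    then have "\<gamma> < \<delta>" using less.prems by simp
    show ?thesis
    proof (rule closed_subset_max_or_cofinal[OF C less.prems(1) \<gamma> \<open>\<gamma> < \<delta>\<close>])
      fix \<delta>' assume d: "\<delta>' \<in> C" "\<gamma> \<le> \<delta>'" "\<delta>' < \<delta>" "\<And>\<beta>. \<beta> \<in> C \<Longrightarrow> \<beta> < \<delta> \<Longrightarrow> \<beta> \<le> \<delta>'"
      have con: "consecutive C \<delta>' \<delta>" using d less.prems(1) by (force simp: consecutive_def)
      have l: "\<delta>' < \<beta>" using d less.prems by simp
      have "t y = t' y" if "y \<le> \<delta>'" for y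
      proof (cases "y = \<delta>'")
        case True
        then show ?thesis using t d l by (simp add: follows_def)
      next
        case False
        then show ?thesis using less.IH[of \<delta>' y] d l that by simp
      qed
      then have "t |` {..\<delta>'} = t' |` {..\<delta>'}" by (simp add: restrict_eq_iff)
      moreover have "u |` {..<\<delta>} = pick (Lev \<delta>) (guess \<delta>) (u |` {..\<delta>'})"
        if "follows C \<eta> \<gamma> \<beta> u" for u
        using that d l con less.prems unfolding follows_def by blast
      ultimately have "t |` {..<\<delta>} = t' |` {..<\<delta>}" using t by simp
      then show ?thesis using less.prems(4) by (simp add: restrict_eq_iff)
    next
      assume "\<And>\<beta>. \<beta> < \<delta> \<Longrightarrow> \<exists>\<delta>'\<in>C. \<beta> < \<delta>' \<and> \<gamma> \<le> \<delta>' \<and> \<delta>' < \<delta>"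
      then obtain \<delta>' where "\<delta>' \<in> C" "x < \<delta>'" "\<gamma> \<le> \<delta>'" "\<delta>' < \<delta>" using less.prems by blast
      then show ?thesis using less.IH[of \<delta>' x] less.prems by simp
    qed
  qed
qed

text \<open>Partial climbs chosen at different points of \<open>C\<close> agree by
  \<open>follows_unique\<close>, so their union is a climb to \<sigma>. Whether the union is itself
  a node is left open: along vanishing branches of \<open>K\<close> this is to fail.\<close>

lemma follows_glue:
  assumes C: "closed_subset {..<\<alpha>} C" and \<gamma>: "\<gamma> \<in> C" "\<gamma> < \<sigma>" and x: "x \<in> Lev \<gamma>"
    and cof: "\<And>\<beta>. \<beta> < \<sigma> \<Longrightarrow> \<exists>\<delta>\<in>C. \<beta> < \<delta> \<and> \<gamma> \<le> \<delta> \<and> \<delta> < \<sigma>"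
    and ex: "\<And>\<delta>. \<delta> \<in> C \<Longrightarrow> \<gamma> \<le> \<delta> \<Longrightarrow> \<delta> < \<sigma> \<Longrightarrow>
      \<exists>t\<in>Lev \<delta>. x \<subseteq>\<^sub>m t \<and> follows C \<eta> \<gamma> \<delta> t"
  shows "\<exists>t. dom t = {..<\<sigma>} \<and> (\<forall>\<beta><\<sigma>. t |` {..<\<beta>} \<in> Lev \<beta>) \<and> x \<subseteq>\<^sub>m t \<and> follows C \<eta> \<gamma> \<sigma> t"
proof -
  obtain F where F: "\<And>\<delta>. \<delta> \<in> C \<Longrightarrow> \<gamma> \<le> \<delta> \<Longrightarrow> \<delta> < \<sigma> \<Longrightarrow>
      F \<delta> \<in> Lev \<delta> \<and> x \<subseteq>\<^sub>m F \<delta> \<and> follows C \<eta> \<gamma> \<delta> (F \<delta>)"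
    using ex by metis
  obtain c where c: "\<And>\<beta>. \<beta> < \<sigma> \<Longrightarrow> c \<beta> \<in> C \<and> \<beta> < c \<beta> \<and> \<gamma> \<le> c \<beta> \<and> c \<beta> < \<sigma>"
    using cof by metis
  have coh: "F \<delta> y = F \<delta>' y"
    if d: "\<delta> \<in> C" "\<gamma> \<le> \<delta>" "\<delta> \<le> \<delta>'" "\<delta>' \<in> C" "\<delta>' < \<sigma>" "y < \<delta>" for \<delta> \<delta>' y
  proof (rule follows_unique[OF C \<gamma>(1), of \<eta> \<delta> _ _ \<delta>])
    show "follows C \<eta> \<gamma> \<delta> (F \<delta>)" "follows C \<eta> \<gamma> \<delta> (F \<delta>')"
      using F d follows_mono[of C \<eta> \<gamma> \<delta>' "F \<delta>'" \<delta>] by auto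
    show "F \<delta> y = F \<delta>' y" if "y < \<gamma>" for y
      using that F[of \<delta>] F[of \<delta>'] d Lev_dom[OF x] unfolding map_le_def
      by (metis lessThan_iff order.strict_trans1 order.trans)
  qed (use d in auto)
  \<comment> \<open>The value at \<open>y\<close> is read off the climb to \<open>c y\<close>, a
    point of \<open>C\<close> beyond \<open>y\<close>.\<close>
  define t where "t y = (if y < \<sigma> then F (c y) y else None)" for y
  have tF: "t y = F \<delta> y" if "\<delta> \<in> C" "\<gamma> \<le> \<delta>" "\<delta> < \<sigma>" "y < \<delta>" for \<delta> y
  proof -
    have "y < \<sigma>" using that by simp
    note cy = c[OF this]
    have "F (c y) y = F \<delta> y"
      using coh[of \<delta> "c y" y] coh[of "c y" \<delta> y] cy that by (metis linear)
    then show ?thesis using \<open>y < \<sigma>\<close> by (simp add: t_def)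
  qed
  have res: "t |` {..<\<delta>} = F \<delta>" if "\<delta> \<in> C" "\<gamma> \<le> \<delta>" "\<delta> < \<sigma>" for \<delta>
  proof -
    have "t |` {..<\<delta>} = F \<delta> |` {..<\<delta>}" using tF[OF that] by (simp add: restrict_eq_iff)
    also have "\<dots> = F \<delta>" using F[OF that] Lev_dom[of "F \<delta>" \<delta>] by (simp add: restrict_superset)
    finally show ?thesis .
  qed
  have "dom t = {..<\<sigma>}"
  proof -
    have "y \<in> dom (F (c y))" if "y < \<sigma>" for y
      using F[of "c y"] c[OF that] Lev_dom by auto
    then show ?thesis by (force simp: t_def dom_def split: if_splits)
  qed
  moreover have "t |` {..<\<beta>} \<in> Lev \<beta>" if "\<beta> < \<sigma>" for \<beta>
  proof -
    have "(t |` {..<c \<beta>}) |` {..<\<beta>} = t |` {..<\<beta>}"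
      using c[OF that] by (auto simp: fun_eq_iff restrict_map_def)
    then show ?thesis
      using res[of "c \<beta>"] F[of "c \<beta>"] c[OF that] Lev_restrict[of "F (c \<beta>)" "c \<beta>" \<beta>]
      by (simp add: less_imp_le)
  qed
  moreover have "x \<subseteq>\<^sub>m t"
    using F[of \<gamma>] res[of \<gamma>] \<gamma> x Lev_dom
    by (metis Lev_extends_iff order_refl restrict_superset)
  moreover have "follows C \<eta> \<gamma> \<sigma> t"
  proof (rule follows_limit[OF cof])
    show "follows C \<eta> \<gamma> \<delta> t" if "\<delta> \<in> C" "\<gamma> \<le> \<delta>" "\<delta> < \<sigma>" for \<delta>
      using F[OF that] tF[OF that] follows_cong[of \<delta> t "F \<delta>"] by simp
  qed
  ultimately show ?thesis by blast
qed

text \<open>From \<epsilon> on, \<open>C\<close> and \<open>D\<close> have the same points below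
  \<beta>, so consecutive pairs of \<open>D\<close> are consecutive in \<open>C\<close>. Labels
  below \<beta> see only the restriction of \<eta> to \<beta>, which may replace \<eta>.\<close>

lemma follows_coherent:
  assumes f: "follows C \<eta> \<gamma> \<beta> t" and "D \<subseteq> {..<\<beta>}"
    and D: "\<And>\<delta>. \<epsilon> \<le> \<delta> \<Longrightarrow> \<delta> < \<beta> \<Longrightarrow> \<delta> \<in> D \<longleftrightarrow> \<delta> \<in> C" and "\<gamma> \<le> \<gamma>'" "\<epsilon> \<le> \<gamma>'"
  shows "follows D (\<eta> |` {..<\<beta>}) \<gamma>' \<beta> t"
  unfolding follows_def
proof (intro ballI impI)
  fix \<delta> assume \<delta>: "\<delta> \<in> D" "\<gamma>' \<le> \<delta>" "\<delta> < \<beta>"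
  then have C: "\<delta> \<in> C" "\<gamma> \<le> \<delta>" using D[of \<delta>] assms(4,5) by auto
  have "lab \<delta> (\<eta> |` {..<\<beta>}) = lab \<delta> \<eta>"
  proof -
    have "(\<eta> |` {..<\<beta>}) |` {..<\<delta>} = \<eta> |` {..<\<delta>}"
      using \<delta>(3) by (auto simp: fun_eq_iff restrict_map_def)
    then show ?thesis by (simp add: lab_def)
  qed
  moreover have "consecutive C \<delta> \<delta>'" if "consecutive D \<delta> \<delta>'" for \<delta>'
  proof -
    have "\<delta>' \<in> D" "\<delta> < \<delta>'" using that by (auto simp: consecutive_def)
    then have "\<delta>' < \<beta>" using assms(2) by auto
    have "\<beta>' \<in> D" if "\<beta>' \<in> C" "\<delta> < \<beta>'" "\<beta>' < \<delta>'" for \<beta>'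
      using D[of \<beta>'] that \<open>\<delta>' < \<beta>\<close> \<delta>(2) assms(5) by auto
    then show ?thesis
      using that C D[of \<delta>'] \<open>\<delta>' < \<beta>\<close> \<delta>(2) assms(5) by (auto simp: consecutive_def)
  qed
  ultimately show "t \<delta> = Some (lab \<delta> (\<eta> |` {..<\<beta>})) \<and>
      (\<forall>\<delta>'\<in>D. \<delta>' \<le> \<beta> \<longrightarrow> consecutive D \<delta> \<delta>' \<longrightarrow>
        t |` {..<\<delta>'} = pick (Lev \<delta>') (guess \<delta>') (t |` {..\<delta>}))"
    using f C \<delta>(3) D unfolding follows_def by (metis consecutive_def)
qed

text \<open>Induction along \<open>C\<close>, using \<open>pick\<close> after a predecessor and
  gluing at accumulation points. The extension property is a hypothesis because the lemma serves
  inside the induction for \<open>Lev_extend\<close>. Only proper restrictions of \<eta> have to lie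
  in \<open>K\<close>, which admits limits of vanishing branches.\<close>

lemma follows_exists:
  assumes \<alpha>: "limit_ord \<alpha>"
    and ext: "\<And>\<beta> \<beta>' s. \<beta> \<le> \<beta>' \<Longrightarrow> \<beta>' < \<alpha> \<Longrightarrow> s \<in> Lev \<beta> \<Longrightarrow> \<exists>t\<in>Lev \<beta>'. s \<subseteq>\<^sub>m t"
    and C: "C \<in> \<C> \<alpha>"
    and \<eta>: "\<And>\<beta>. \<beta> < \<alpha> \<Longrightarrow> \<eta> |` {..<\<beta>} \<in> level K \<beta>"
    and \<gamma>: "\<gamma> \<in> C" and x: "x \<in> Lev \<gamma>"
  shows "\<exists>t. dom t = {..<\<alpha>} \<and> (\<forall>\<beta><\<alpha>. t |` {..<\<beta>} \<in> Lev \<beta>) \<and> x \<subseteq>\<^sub>m t \<and> follows C \<eta> \<gamma> \<alpha> t"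
proof -
  note closed = \<C>_closed[OF C]
  have sub: "\<delta> < \<alpha>" if "\<delta> \<in> C" for \<delta> using \<C>_subset[OF C] that by auto
  have main: "\<exists>t\<in>Lev \<beta>. x \<subseteq>\<^sub>m t \<and> follows C \<eta> \<gamma> \<beta> t" if "\<beta> \<in> C" "\<gamma> \<le> \<beta>" for \<beta>
    using that
  proof (induction \<beta> rule: less_induct)
    case (less \<beta>)
    show ?case
    proof (cases "\<beta> = \<gamma>")
      case True
      moreover have "follows C \<eta> \<gamma> \<gamma> x" unfolding follows_def by (meson leD)
      ultimately show ?thesis using x map_le_refl by blast
    next
      case False
      then have "\<gamma> < \<beta>" using less.prems by simp
      have "\<beta> < \<alpha>" using sub less.prems by simp
      show ?thesis
      proof (rule closed_subset_max_or_cofinal[OF closed less.prems(1) \<gamma> \<open>\<gamma> < \<beta>\<close>])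
        fix \<delta> assume d: "\<delta> \<in> C" "\<gamma> \<le> \<delta>" "\<delta> < \<beta>" "\<And>\<beta>'. \<beta>' \<in> C \<Longrightarrow> \<beta>' < \<beta> \<Longrightarrow> \<beta>' \<le> \<delta>"
        obtain s where s: "s \<in> Lev \<delta>" "x \<subseteq>\<^sub>m s" "follows C \<eta> \<gamma> \<delta> s"
          using less.IH[of \<delta>] d by blast
        \<comment> \<open>First the code of \<eta> is written at \<delta>; then \<open>pick\<close>
          leads from level \<open>osuc \<delta>\<close> to level \<beta>.\<close>
        define z where "z = s(\<delta> \<mapsto> lab \<delta> \<eta>)"
        have "lab \<delta> \<eta> \<in> labels \<delta>"
          using \<eta>[OF sub[OF d(1)]] by (auto simp: lab_def labels_def)
        then have z: "z \<in> Lev (osuc \<delta>)" unfolding z_def using s Lev_update by blast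
        define t where "t = pick (Lev \<beta>) (guess \<beta>) z"
        obtain t0 where "t0 \<in> Lev \<beta>" "z \<subseteq>\<^sub>m t0"
          using ext[OF osuc_le[OF d(3)] \<open>\<beta> < \<alpha>\<close> z] by blast
        then have t: "t \<in> Lev \<beta>" "z \<subseteq>\<^sub>m t" unfolding t_def by (rule pick_extends)+
        have tz: "t |` {..\<delta>} = z" using t(2) Lev_extends_iff[OF z] by (simp add: lessThan_osuc)
        have ts: "t y = s y" if "y < \<delta>" for y
          using fun_cong[OF tz, of y] that less_imp_neq[OF that] by (simp add: z_def)
        have "x \<subseteq>\<^sub>m t"
          using s(2) ts Lev_dom[OF x] d(2) unfolding map_le_def
          by (metis lessThan_iff order.strict_trans2)
        moreover have "follows C \<eta> \<gamma> \<beta> t"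
          unfolding follows_def
        proof (intro ballI impI conjI)
          have f: "follows C \<eta> \<gamma> \<delta> t" using s(3) follows_cong[of \<delta> t s] ts by simp
          fix \<delta>1 assume d1: "\<delta>1 \<in> C" "\<gamma> \<le> \<delta>1" "\<delta>1 < \<beta>"
          then have "\<delta>1 \<le> \<delta>" using d(4) by blast
          show "t \<delta>1 = Some (lab \<delta>1 \<eta>)"
          proof (cases "\<delta>1 = \<delta>")
            case True
            then show ?thesis using fun_cong[OF tz, of \<delta>] by (simp add: z_def)
          next
            case False
            then show ?thesis using f d1 \<open>\<delta>1 \<le> \<delta>\<close> by (simp add: follows_def)
          qed
          fix \<delta>2 assume d2: "\<delta>2 \<in> C" "\<delta>2 \<le> \<beta>" "consecutive C \<delta>1 \<delta>2"
          show "t |` {..<\<delta>2} = pick (Lev \<delta>2) (guess \<delta>2) (t |` {..\<delta>1})"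
          proof (cases "\<delta>1 = \<delta>")
            case True
            \<comment> \<open>As \<delta> is the last point of \<open>C\<close> below \<beta>, a
              consecutive pair starting there can only end at \<beta>, where \<open>t\<close> was
              picked.\<close>
            then have "\<not> \<delta>2 < \<beta>" using d(4)[of \<delta>2] d2 by (meson consecutive_def leD)
            then have "\<delta>2 = \<beta>" using d2 by simp
            then show ?thesis
              using True tz t(1) Lev_dom[of t \<beta>] by (simp add: t_def restrict_superset)
          next
            case False
            then have "\<delta>1 < \<delta>" using \<open>\<delta>1 \<le> \<delta>\<close> by simp
            moreover have "\<delta>2 \<le> \<delta>"
              using d2 d(1) \<open>\<delta>1 < \<delta>\<close> unfolding consecutive_def by (meson not_less)
            ultimately show ?thesis using f d1 d2 unfolding follows_def by blast
          qed
        qed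
        ultimately show ?thesis using t by blast
      next
        assume cof: "\<And>\<beta>'. \<beta>' < \<beta> \<Longrightarrow> \<exists>\<delta>\<in>C. \<beta>' < \<delta> \<and> \<gamma> \<le> \<delta> \<and> \<delta> < \<beta>"
        obtain t where t: "dom t = {..<\<beta>}" "\<And>\<beta>'. \<beta>' < \<beta> \<Longrightarrow> t |` {..<\<beta>'} \<in> Lev \<beta>'"
          "x \<subseteq>\<^sub>m t" "follows C \<eta> \<gamma> \<beta> t"
          using follows_glue[OF closed \<gamma> \<open>\<gamma> < \<beta>\<close> x cof, of \<eta>] less.IH by blast
        \<comment> \<open>Coherence enters here: the union \<open>t\<close> is a node of level
          \<beta> because it also follows some \<open>D\<close> in \<open>\<C> \<beta>\<close>, with
          the restriction of \<eta> to \<beta>, a node of \<open>K\<close>, in place of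
          \<eta>.\<close>
        have "\<beta> \<in> acc_pts C"
          unfolding acc_pts_iff using cof less.prems(1) \<open>\<gamma> < \<beta>\<close> ord_zero_le[of \<gamma>] by force
        then obtain D where D: "D \<in> \<C> \<beta>" "D \<sqsubseteq>\<^sub>* C" using \<C>_coherent[OF C] by blast
        have lim: "limit_ord \<beta>" using \<open>\<beta> \<in> acc_pts C\<close> by (rule acc_pts_limit)
        have "osup D = \<beta>" using \<C>_osup[OF D(1)] osup_lessThan_limit[OF lim] by simp
        then obtain \<epsilon> \<zeta> where \<epsilon>: "\<epsilon> < \<beta>" "D - {..<\<epsilon>} = (C - {..<\<epsilon>}) \<inter> {..<\<zeta>}"
          using D(2) unfolding init_seg_star_def init_seg_def by blast
        \<comment> \<open>\<open>D\<close> is cofinal in \<beta>, so the cut \<zeta> of the initial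
          segment lies above every \<delta> < \<beta>.\<close>
        have agree: "\<delta> \<in> D \<longleftrightarrow> \<delta> \<in> C" if \<delta>: "\<epsilon> \<le> \<delta>" "\<delta> < \<beta>" for \<delta>
        proof -
          obtain \<delta>' where "\<delta>' \<in> D" "\<delta> < \<delta>'" using \<C>_cofinal[OF D(1) lim \<delta>(2)] by blast
          moreover have "\<delta>' \<in> D - {..<\<epsilon>}" using calculation \<delta>(1) by auto
          then have "\<delta>' < \<zeta>" unfolding \<epsilon>(2) by simp
          ultimately have "\<delta> < \<zeta>" by simp
          have "\<delta> \<in> D \<longleftrightarrow> \<delta> \<in> D - {..<\<epsilon>}" using \<delta>(1) by auto
          also have "\<dots> \<longleftrightarrow> \<delta> \<in> C" unfolding \<epsilon>(2) using \<delta>(1) \<open>\<delta> < \<zeta>\<close> by auto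
          finally show ?thesis .
        qed
        have "max \<gamma> \<epsilon> < \<beta>" using \<open>\<gamma> < \<beta>\<close> \<epsilon>(1) by simp
        then obtain \<gamma>' where \<gamma>': "\<gamma>' \<in> D" "max \<gamma> \<epsilon> < \<gamma>'" using \<C>_cofinal[OF D(1) lim] by blast
        have "follows D (\<eta> |` {..<\<beta>}) \<gamma>' \<beta> t"
          by (rule follows_coherent[OF t(4) \<C>_subset[OF D(1)] agree]) (use \<gamma>' in auto)
        then have "t \<in> Lev \<beta>"
          using Lev_limitI[OF lim t(1) _ D(1) \<eta>[OF \<open>\<beta> < \<alpha>\<close>] \<gamma>'(1)] t(2) by blast
        then show ?thesis using t by blast
      qed
    qed
  qed
  have cof: "\<exists>\<delta>\<in>C. \<beta> < \<delta> \<and> \<gamma> \<le> \<delta> \<and> \<delta> < \<alpha>" if "\<beta> < \<alpha>" for \<beta>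
  proof -
    have "max \<beta> \<gamma> < \<alpha>" using that sub[OF \<gamma>] by simp
    then obtain \<delta> where "\<delta> \<in> C" "max \<beta> \<gamma> < \<delta>" using \<C>_cofinal[OF C \<alpha>] by blast
    then show ?thesis using sub by (auto intro!: bexI[of _ \<delta>])
  qed
  show ?thesis
    by (rule follows_glue[OF closed \<gamma> sub[OF \<gamma>] x cof]) (use main in blast)+
qed

section \<open>Extending nodes to higher levels\<close>

lemma level_K_restrict: "\<eta> \<in> level K \<alpha> \<Longrightarrow> \<beta> \<le> \<alpha> \<Longrightarrow> \<eta> |` {..<\<beta>} \<in> level K \<beta>"
proof -
  assume \<eta>: "\<eta> \<in> level K \<alpha>" and "\<beta> \<le> \<alpha>"
  then have "dom (\<eta> |` {..<\<beta>}) = {..<\<beta>}" by (auto simp: level_def seqs_def)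
  moreover have "ran (\<eta> |` {..<\<beta>}) \<subseteq> ran \<eta>"
    by (auto simp: ran_def restrict_map_def split: if_splits)
  moreover have "\<eta> |` {..<\<beta>} \<in> K"
    using \<eta> tree_K by (simp add: streamlined_tree_def level_def)
  ultimately show ?thesis using \<eta> by (auto simp: level_def seqs_def)
qed

lemma level_K_nonempty: "level K \<alpha> \<noteq> {}" and level_K_small: "|level K \<alpha>| <o (kappa :: 'k rel)"
  using tree_K by (auto simp: streamlined_tree_def)

text \<open>At a limit \<alpha>, one moves up to a level \<gamma> in some \<open>C\<close> and then
  climbs along any \<eta> in level \<alpha> of \<open>K\<close>. Since this \<eta> is a node of
  \<open>K\<close>, the result belongs to \<open>Lev \<alpha>\<close>.\<close>

lemma Lev_extend: "\<beta> \<le> \<alpha> \<Longrightarrow> s \<in> Lev \<beta> \<Longrightarrow> \<exists>t\<in>Lev \<alpha>. s \<subseteq>\<^sub>m t"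
proof (induction \<alpha> arbitrary: \<beta> s rule: less_induct)
  case (less \<alpha>)
  show ?case
  proof (cases "\<beta> = \<alpha>")
    case True
    then show ?thesis using less.prems map_le_refl by blast
  next
    case False
    then have "\<beta> < \<alpha>" using less.prems by simp
    show ?thesis
    proof (cases \<alpha> rule: ord_cases)
      case zero
      then show ?thesis using \<open>\<beta> < \<alpha>\<close> not_less_ord_zero by blast
    next
      case (succ \<gamma>)
      then have "\<beta> \<le> \<gamma>" "\<gamma> < \<alpha>" using \<open>\<beta> < \<alpha>\<close> less_osuc by (auto simp: less_osuc_iff)
      then obtain t where t: "t \<in> Lev \<gamma>" "s \<subseteq>\<^sub>m t" using less.IH less.prems by blast
      have "t(\<gamma> \<mapsto> von_neumann ord_zero) \<in> Lev \<alpha>"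
        unfolding succ by (rule Lev_update[OF t(1)]) (simp add: labels_def)
      moreover have "t \<subseteq>\<^sub>m t(\<gamma> \<mapsto> von_neumann ord_zero)"
        using Lev_dom[OF t(1)] by (auto simp: map_le_def)
      ultimately show ?thesis using t map_le_trans by blast
    next
      case limit
      obtain C where C: "C \<in> \<C> \<alpha>" using \<C>_nonempty by blast
      obtain \<eta> where \<eta>: "\<eta> \<in> level K \<alpha>" using level_K_nonempty by blast
      obtain \<gamma> where \<gamma>: "\<gamma> \<in> C" "\<beta> < \<gamma>" using \<C>_cofinal[OF C limit \<open>\<beta> < \<alpha>\<close>] by blast
      have "\<gamma> < \<alpha>" using \<C>_subset[OF C] \<gamma> by auto
      then obtain x where x: "x \<in> Lev \<gamma>" "s \<subseteq>\<^sub>m x"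
        using less.IH[of \<gamma> \<beta> s] \<gamma> less.prems less_imp_le by blast
      have "\<exists>t. dom t = {..<\<alpha>} \<and> (\<forall>\<beta><\<alpha>. t |` {..<\<beta>} \<in> Lev \<beta>) \<and> x \<subseteq>\<^sub>m t \<and> follows C \<eta> \<gamma> \<alpha> t"
        by (rule follows_exists[OF limit less.IH C level_K_restrict[OF \<eta>] \<gamma>(1) x(1)])
          (auto dest: less_imp_le)
      then obtain t where t: "dom t = {..<\<alpha>}" "\<And>\<beta>. \<beta> < \<alpha> \<Longrightarrow> t |` {..<\<beta>} \<in> Lev \<beta>"
        "x \<subseteq>\<^sub>m t" "follows C \<eta> \<gamma> \<alpha> t" by blast
      have "t \<in> Lev \<alpha>" using Lev_limitI[OF limit t(1) _ C \<eta> \<gamma>(1) t(4)] t(2) by blast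
      then show ?thesis using t(3) x(2) map_le_trans by blast
    qed
  qed
qed

section \<open>Sizes of the levels\<close>

lemma labels_small: "|labels \<alpha>| <o (kappa :: 'k rel)"
  unfolding labels_def by (intro small_Un small_image level_K_small small_finite) auto

text \<open>At a limit, a node is determined by \<open>C\<close>, \<eta>, \<gamma> and its
  restriction to \<gamma>. Each of these has fewer than \<kappa> possible values, and regularity
  bounds their combination.\<close>

lemma Lev_small: "|Lev \<alpha>| <o (kappa :: 'k rel)"
proof (induction \<alpha> rule: less_induct)
  case (less \<alpha>)
  show ?case
  proof (cases \<alpha> rule: ord_cases)
    case zero
    have "Lev \<alpha> \<subseteq> {Map.empty}"
      using Lev_dom[of _ \<alpha>] not_less_ord_zero unfolding zero by fastforce
    then show ?thesis by (rule small_mono) (simp add: small_finite)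
  next
    case (succ \<gamma>)
    have "Lev \<alpha> \<subseteq> (\<lambda>(t, c). t(\<gamma> \<mapsto> c)) ` (Lev \<gamma> \<times> labels \<gamma>)"
    proof
      fix t assume t: "t \<in> Lev \<alpha>"
      have "\<gamma> < \<alpha>" unfolding succ by (rule less_osuc)
      then obtain c where c: "c \<in> labels \<gamma>" "t \<gamma> = Some c"
        using Lev_iff[of t \<alpha>] t by blast
      have eq: "(t |` {..<\<gamma>})(\<gamma> \<mapsto> c) = t"
      proof
        fix y
        have "t y = None" if "\<gamma> < y"
          using that Lev_dom[OF t] unfolding succ lessThan_osuc by (metis atMost_iff domIff leD)
        then show "((t |` {..<\<gamma>})(\<gamma> \<mapsto> c)) y = t y"
          using c(2) by (cases y \<gamma> rule: linorder_cases) (auto simp: restrict_map_def)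
      qed
      have "t |` {..<\<gamma>} \<in> Lev \<gamma>" using Lev_restrict[OF t] \<open>\<gamma> < \<alpha>\<close> by simp
      with c(1) have "(\<lambda>(t, c). t(\<gamma> \<mapsto> c)) (t |` {..<\<gamma>}, c) \<in> (\<lambda>(t, c). t(\<gamma> \<mapsto> c)) ` (Lev \<gamma> \<times> labels \<gamma>)"
        by (intro imageI SigmaI)
      then show "t \<in> (\<lambda>(t, c). t(\<gamma> \<mapsto> c)) ` (Lev \<gamma> \<times> labels \<gamma>)" by (simp only: prod.case eq)
    qed
    moreover have "|Lev \<gamma>| <o (kappa :: 'k rel)"
      using less.IH less_osuc succ by blast
    ultimately show ?thesis
      by (elim small_mono) (intro small_image small_Times labels_small)
  next
    case limit
    \<comment> \<open>Each of these sets has at most one element. As \<gamma> will range over all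
      ordinals below \<alpha>, membership of \<gamma> in \<open>C\<close> is built in.\<close>
    define P where "P C \<eta> \<gamma> x = {t. \<gamma> \<in> C \<and> dom t = {..<\<alpha>} \<and> follows C \<eta> \<gamma> \<alpha> t \<and> t |` {..<\<gamma>} = x}"
      for C \<eta> \<gamma> x
    have "Lev \<alpha> \<subseteq> (\<Union>C\<in>\<C> \<alpha>. \<Union>\<eta>\<in>level K \<alpha>. \<Union>\<gamma>\<in>{..<\<alpha>}. \<Union>x\<in>Lev \<gamma>. P C \<eta> \<gamma> x)"
    proof
      fix t assume t: "t \<in> Lev \<alpha>"
      then obtain C \<eta> \<gamma> where *: "C \<in> \<C> \<alpha>" "\<eta> \<in> level K \<alpha>" "\<gamma> \<in> C" "follows C \<eta> \<gamma> \<alpha> t"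
        using Lev_iff[of t \<alpha>] limit by blast
      moreover have "\<gamma> < \<alpha>" using \<C>_subset[OF *(1)] *(3) by auto
      moreover from this have "t |` {..<\<gamma>} \<in> Lev \<gamma>" using Lev_restrict[OF t] by simp
      ultimately show "t \<in> (\<Union>C\<in>\<C> \<alpha>. \<Union>\<eta>\<in>level K \<alpha>. \<Union>\<gamma>\<in>{..<\<alpha>}. \<Union>x\<in>Lev \<gamma>. P C \<eta> \<gamma> x)"
        using Lev_dom[OF t] by (auto simp: P_def)
    qed
    moreover have "|P C \<eta> \<gamma> x| <o (kappa :: 'k rel)" if C: "C \<in> \<C> \<alpha>" for C \<eta> \<gamma> x
    proof -
      have "t = t'" if tt: "t \<in> P C \<eta> \<gamma> x" "t' \<in> P C \<eta> \<gamma> x" for t t'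
      proof
        fix y
        show "t y = t' y"
        proof (cases "y < \<alpha>")
          case True
          have \<gamma>: "\<gamma> \<in> C" using tt by (simp add: P_def)
          then have "max y \<gamma> < \<alpha>" using True \<C>_subset[OF C] by auto
          then obtain \<delta> where "\<delta> \<in> C" "max y \<gamma> < \<delta>" using \<C>_cofinal[OF C limit] by blast
          moreover have "\<delta> < \<alpha>" using \<C>_subset[OF C] \<open>\<delta> \<in> C\<close> by auto
          moreover have "t z = t' z" if "z < \<gamma>" for z
          proof -
            have "t |` {..<\<gamma>} = t' |` {..<\<gamma>}" using tt by (simp add: P_def)
            then show ?thesis using that unfolding restrict_eq_iff by blast
          qed
          ultimately show ?thesis
            using follows_unique[OF \<C>_closed[OF C] \<gamma>, of \<eta> \<alpha> t t' \<delta> y] tt by (auto simp: P_def)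
        next
          case False
          then have "y \<notin> dom t" "y \<notin> dom t'" using tt by (auto simp: P_def)
          then show ?thesis by (simp add: domIff)
        qed
      qed
      then have "P C \<eta> \<gamma> x = {} \<or> (\<exists>t. P C \<eta> \<gamma> x = {t})" by blast
      then show ?thesis by (auto intro: small_finite)
    qed
    ultimately show ?thesis
      by (elim small_mono) (intro small_UN \<C>_small level_K_small small_lessThan less.IH; simp)
  qed
qed

lemma Lev_coded: "Lev \<alpha> \<subseteq> coded_nodes"
proof
  fix t assume t: "t \<in> Lev \<alpha>"
  have "c \<in> range von_neumann" if c: "c \<in> ran t" for c
  proof -
    obtain \<beta> where "t \<beta> = Some c" using c by (auto simp: ran_def)
    then have "c \<in> labels \<beta>" using t Lev_iff[of t \<alpha>] by (metis domI image_iff lessThan_iff option.inject)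
    then show ?thesis by (auto simp: labels_def)
  qed
  then show "t \<in> coded_nodes" using Lev_dom[OF t] by (auto simp: coded_nodes_def)
qed

section \<open>The tree and the sealing of dense sets\<close>

definition tree :: "'k node set" where
  "tree = (\<Union>\<alpha>. Lev \<alpha>)"

lemma Lev_tree: "t \<in> Lev \<alpha> \<Longrightarrow> t \<in> tree"
  by (auto simp: tree_def)

lemma Lev_ht: "t \<in> Lev \<alpha> \<Longrightarrow> ht t = \<alpha>"
  using Lev_dom ht_eq by blast

lemma tree_Lev_ht: "t \<in> tree \<Longrightarrow> t \<in> Lev (ht t)"
  using Lev_ht by (auto simp: tree_def)

text \<open>At a level \<alpha> given by the hitting property for \<open>B\<close>, every node is a
  climb passing a point \<beta> in \<open>B\<close>, where \<open>pick\<close> aims at the guessed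
  copy of \<open>D\<close>. By density and the closure properties of \<beta>, this aim is
  attainable.\<close>

lemma dense_sealed:
  assumes D: "D \<subseteq> tree" and dense: "\<And>t. t \<in> tree \<Longrightarrow> \<exists>d\<in>D. t \<subseteq>\<^sub>m d"
  obtains \<alpha> where "\<And>t. t \<in> Lev \<alpha> \<Longrightarrow> \<exists>d\<in>D. d \<subseteq>\<^sub>m t"
proof -
  obtain h where h: "\<And>t. t \<in> tree \<Longrightarrow> h t \<in> D \<and> t \<subseteq>\<^sub>m h t" using dense by metis
  have "\<exists>\<xi>. \<forall>z\<in>Lev \<gamma>. ht (h z) < \<xi> \<and> e (h z) < \<xi>" for \<gamma>
  proof -
    have "|(\<lambda>z. ht (h z)) ` Lev \<gamma> \<union> (\<lambda>z. e (h z)) ` Lev \<gamma>| <o (kappa :: 'k rel)"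
      by (intro small_Un small_image Lev_small)
    from small_bounded[OF this] show ?thesis by blast
  qed
  then obtain f where f: "\<And>\<gamma> z. z \<in> Lev \<gamma> \<Longrightarrow> ht (h z) < f \<gamma> \<and> e (h z) < f \<gamma>" by metis
  \<comment> \<open>For \<beta> in \<open>B\<close> the codes of \<open>D\<close> are guessed at
    \<beta>, and nodes of height below \<beta> have their chosen extension in \<open>D\<close> of
    height and code below \<beta>.\<close>
  define B where "B = {\<beta>. limit_ord \<beta> \<and> (\<forall>\<gamma><\<beta>. f \<gamma> < \<beta>) \<and> e ` D \<inter> {..<\<beta>} = S \<beta>}"
  have "\<exists>\<beta>\<in>B. \<alpha> \<le> \<beta>" for \<alpha>
    by (rule stationary_closure_point[OF diamond_S[of "e ` D"], of f \<alpha>])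
      (auto simp: B_def intro: less_imp_le)
  then have "cofinal_kappa B" by (simp add: cofinal_kappa_def)
  from \<C>_guess[OF this] obtain \<alpha> where \<alpha>: "limit_ord \<alpha>" "\<forall>C\<in>\<C> \<alpha>. osup (nacc_pts C \<inter> B) = \<alpha>"
    by (rule stationary_closure_point[where f = id]) blast
  have "\<exists>d\<in>D. d \<subseteq>\<^sub>m t" if t: "t \<in> Lev \<alpha>" for t
  proof -
    obtain C \<eta> \<gamma> where C: "C \<in> \<C> \<alpha>" and \<gamma>: "\<gamma> \<in> C" and fol: "follows C \<eta> \<gamma> \<alpha> t"
      using Lev_iff[of t \<alpha>] t \<alpha>(1) by blast
    have sub: "nacc_pts C \<inter> B \<subseteq> {..<\<alpha>}" using \<C>_subset[OF C] by (auto simp: nacc_pts_def)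
    have "\<gamma> < \<alpha>" using \<C>_subset[OF C] \<gamma> by auto
    then obtain \<beta> where \<beta>: "\<beta> \<in> nacc_pts C" "\<beta> \<in> B" "\<gamma> < \<beta>"
      using osup_eq_iff[OF sub] \<alpha>(2) C by blast
    have "\<beta> \<in> C" "\<beta> \<notin> acc_pts C" "\<beta> < \<alpha>" using \<beta> sub by (auto simp: nacc_pts_def)
    \<comment> \<open>A non-accumulation point of \<open>C\<close> beyond \<gamma> has an immediate
      predecessor in \<open>C\<close>, so \<open>pick\<close> was applied between the two.\<close>
    obtain \<delta> where \<delta>: "\<delta> \<in> C" "\<gamma> \<le> \<delta>" "\<delta> < \<beta>" "\<And>\<beta>'. \<beta>' \<in> C \<Longrightarrow> \<beta>' < \<beta> \<Longrightarrow> \<beta>' \<le> \<delta>"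
    proof (rule closed_subset_max_or_cofinal[OF \<C>_closed[OF C] \<open>\<beta> \<in> C\<close> \<gamma> \<open>\<gamma> < \<beta>\<close>])
      assume "\<And>\<beta>'. \<beta>' < \<beta> \<Longrightarrow> \<exists>\<delta>\<in>C. \<beta>' < \<delta> \<and> \<gamma> \<le> \<delta> \<and> \<delta> < \<beta>"
      then have "\<beta> \<in> acc_pts C"
        unfolding acc_pts_iff using \<open>\<beta> \<in> C\<close> \<open>\<gamma> < \<beta>\<close> ord_zero_le[of \<gamma>] by force
      then show thesis using \<open>\<beta> \<notin> acc_pts C\<close> by blast
    qed (use that in blast)
    have "consecutive C \<delta> \<beta>" using \<delta> \<open>\<beta> \<in> C\<close> by (force simp: consecutive_def)
    then have t\<beta>: "t |` {..<\<beta>} = pick (Lev \<beta>) (guess \<beta>) (t |` {..\<delta>})"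
      using fol \<delta> \<open>\<beta> \<in> C\<close> \<open>\<beta> < \<alpha>\<close> unfolding follows_def
      by (meson less_imp_le less_trans)
    have lim: "limit_ord \<beta>" and cl: "\<And>\<gamma>. \<gamma> < \<beta> \<Longrightarrow> f \<gamma> < \<beta>" and S: "e ` D \<inter> {..<\<beta>} = S \<beta>"
      using \<beta>(2) by (auto simp: B_def)
    define z where "z = t |` {..\<delta>}"
    have "osuc \<delta> < \<beta>" using osuc_less_limit[OF lim \<delta>(3)] .
    then have z: "z \<in> Lev (osuc \<delta>)"
      using Lev_restrict[OF t, of "osuc \<delta>"] \<open>\<beta> < \<alpha>\<close> by (simp add: z_def lessThan_osuc)
    have hz: "h z \<in> D" "z \<subseteq>\<^sub>m h z" using h[OF Lev_tree[OF z]] by auto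
    have "ht (h z) < \<beta>" "e (h z) < \<beta>"
      using f[OF z] cl[OF \<open>osuc \<delta> < \<beta>\<close>] by auto
    have "h z \<in> tree" using hz D by blast
    then obtain t' where t': "t' \<in> Lev \<beta>" "h z \<subseteq>\<^sub>m t'"
      using Lev_extend[OF less_imp_le[OF \<open>ht (h z) < \<beta>\<close>] tree_Lev_ht] by blast
    have "h z \<in> guess \<beta>"
      using S hz \<open>e (h z) < \<beta>\<close> \<open>h z \<in> tree\<close> Lev_coded by (force simp: guess_def tree_def)
    from pick_seals[OF t'(1) map_le_trans[OF hz(2) t'(2)] this t'(2)]
    obtain d where d: "d \<in> guess \<beta>" "d \<subseteq>\<^sub>m t |` {..<\<beta>}"
      unfolding t\<beta> z_def by blast
    \<comment> \<open>The guessed node \<open>d\<close> is really in \<open>D\<close>: its code is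
      the code of an element of \<open>D\<close>, and \<open>e\<close> is injective on
      \<open>coded_nodes\<close>.\<close>
    have "e d \<in> e ` D" "d \<in> coded_nodes" using d(1) S by (auto simp: guess_def)
    moreover have "D \<subseteq> coded_nodes" using D Lev_coded by (auto simp: tree_def)
    ultimately have "d \<in> D" using inj_e by (simp add: inj_on_image_mem_iff)
    moreover have "t |` {..<\<beta>} \<subseteq>\<^sub>m t" by (auto simp: map_le_def)
    ultimately show ?thesis using d(2) map_le_trans by blast
  qed
  then show thesis by (rule that)
qed

section \<open>Souslinity and vanishing levels\<close>

lemma Lev_seqs: "Lev \<alpha> \<subseteq> seqs \<alpha>"
proof
  fix t assume t: "t \<in> Lev \<alpha>"
  then have "ran t \<subseteq> range von_neumann" using Lev_coded[of \<alpha>] unfolding coded_nodes_def by blast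
  then have "ran t \<subseteq> H_kappa" using von_neumann_H_kappa by blast
  then show "t \<in> seqs \<alpha>" using Lev_dom[OF t] by (simp add: seqs_def)
qed

lemma level_tree: "level tree \<alpha> = Lev \<alpha>"
proof
  show "Lev \<alpha> \<subseteq> level tree \<alpha>" using Lev_seqs by (auto simp: level_def tree_def)
  show "level tree \<alpha> \<subseteq> Lev \<alpha>"
  proof
    fix t assume "t \<in> level tree \<alpha>"
    then have "t \<in> tree" "dom t = {..<\<alpha>}" by (auto simp: level_def seqs_def)
    then show "t \<in> Lev \<alpha>" using tree_Lev_ht ht_eq by metis
  qed
qed

lemma Lev_nonempty: "Lev \<alpha> \<noteq> {}"
  using Lev_extend[OF ord_zero_le Lev_zero] by blast

lemma tree_restrict: "t \<in> tree \<Longrightarrow> t |` {..<\<beta>} \<in> tree"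
proof -
  assume t: "t \<in> tree"
  show ?thesis
  proof (cases "\<beta> \<le> ht t")
    case True
    then show ?thesis using Lev_restrict[OF tree_Lev_ht[OF t]] Lev_tree by blast
  next
    case False
    then have "dom t \<subseteq> {..<\<beta>}" using Lev_dom[OF tree_Lev_ht[OF t]] by auto
    then show ?thesis using t by (simp add: restrict_superset)
  qed
qed

lemma streamlined_tree_tree: "streamlined_tree tree"
  unfolding streamlined_tree_def level_tree
  using Lev_seqs Lev_small Lev_nonempty tree_restrict by (fastforce simp: tree_def)

lemma normal_tree_tree: "normal_tree tree"
  unfolding normal_tree_def level_tree
proof (intro allI impI ballI)
  fix \<alpha> \<beta> s assume ab: "\<alpha> < \<beta>" and s: "s \<in> Lev \<alpha>"
  obtain t where t: "t \<in> Lev \<beta>" "s \<subseteq>\<^sub>m t" using Lev_extend[OF less_imp_le[OF ab] s] by blast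
  moreover have "s \<noteq> t" using ab Lev_ht[OF s] Lev_ht[OF t(1)] by auto
  ultimately show "\<exists>t\<in>Lev \<beta>. s \<subset>\<^sub>m t" by (auto simp: below_def)
qed

lemma below_ht_less:
  assumes "s \<in> tree" "t \<in> tree" "s \<subset>\<^sub>m t"
  shows "ht s < ht t"
proof (rule ccontr)
  assume "\<not> ht s < ht t"
  then have "dom t \<subseteq> dom s"
    using Lev_dom[OF tree_Lev_ht] assms(1,2) by auto
  moreover have "t |` dom s = s" using assms(3) by (simp add: below_def map_le_iff_restrict)
  ultimately show False using assms(3) restrict_superset by (metis below_def)
qed

lemma chain_ht_inj:
  assumes "s \<in> tree" "t \<in> tree" "s \<subset>\<^sub>m t \<or> s = t \<or> t \<subset>\<^sub>m s" "ht s = ht t"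
  shows "s = t"
  using below_ht_less[of s t] below_ht_less[of t s] assms by auto

lemma two_successors:
  assumes s: "s \<in> Lev \<gamma>"
  obtains t u where "t \<in> Lev (osuc \<gamma>)" "u \<in> Lev (osuc \<gamma>)" "s \<subset>\<^sub>m t" "s \<subset>\<^sub>m u" "t \<noteq> u"
proof
  define t where "t \<alpha> = s(\<gamma> \<mapsto> von_neumann \<alpha>)" for \<alpha>
  show "t ord_zero \<in> Lev (osuc \<gamma>)" "t (osuc ord_zero) \<in> Lev (osuc \<gamma>)"
    unfolding t_def by (rule Lev_update[OF s]; simp add: labels_def)+
  have "s \<gamma> = None" using Lev_dom[OF s] by (metis domIff lessThan_iff less_irrefl)
  then have "s \<subseteq>\<^sub>m t \<alpha>" "s \<noteq> t \<alpha>" for \<alpha> by (auto simp: t_def map_le_def fun_eq_iff)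
  then show "s \<subset>\<^sub>m t ord_zero" "s \<subset>\<^sub>m t (osuc ord_zero)" by (auto simp: below_def)
  have "von_neumann ord_zero \<noteq> von_neumann (osuc ord_zero :: 'k)"
    using less_osuc[of ord_zero] inj_von_neumann by (metis injD less_irrefl)
  then show "t ord_zero \<noteq> t (osuc ord_zero)" by (auto simp: t_def fun_eq_iff)
qed

lemma splitting_tree_tree: "splitting_tree tree"
  unfolding splitting_tree_def
proof
  fix s assume s: "s \<in> tree"
  obtain t u where tu: "t \<in> Lev (osuc (ht s))" "u \<in> Lev (osuc (ht s))" "s \<subset>\<^sub>m t" "s \<subset>\<^sub>m u" "t \<noteq> u"
    using two_successors[OF tree_Lev_ht[OF s]] by blast
  have "v \<in> imm_succs tree s" if v: "v \<in> Lev (osuc (ht s))" "s \<subset>\<^sub>m v" for v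
  proof -
    have False if "w \<in> tree" "s \<subset>\<^sub>m w" "w \<subset>\<^sub>m v" for w
      using below_ht_less[OF s that(1,2)] below_ht_less[OF that(1) Lev_tree[OF v(1)] that(3)]
        Lev_ht[OF v(1)] by (simp add: less_osuc_iff)
    then show ?thesis using v Lev_tree by (auto simp: imm_succs_def)
  qed
  then show "\<exists>t\<in>imm_succs tree s. \<exists>u\<in>imm_succs tree s. t \<noteq> u" using tu by blast
qed

text \<open>A cofinal branch would avoid some level, since its complement is dense.\<close>

lemma no_cofinal_branch: "\<not> branch tree UNIV B"
proof
  assume B: "branch tree UNIV B"
  then have sub: "B \<subseteq> tree" and ht: "ht ` B = UNIV"
    and chain: "\<And>s t. s \<in> B \<Longrightarrow> t \<in> B \<Longrightarrow> s \<subset>\<^sub>m t \<or> s = t \<or> t \<subset>\<^sub>m s"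
    by (auto simp: branch_def)
  have "\<exists>d\<in>tree - B. t \<subseteq>\<^sub>m d" if t: "t \<in> tree" for t
  proof -
    obtain u v where uv: "u \<in> Lev (osuc (ht t))" "v \<in> Lev (osuc (ht t))" "t \<subset>\<^sub>m u" "t \<subset>\<^sub>m v" "u \<noteq> v"
      using two_successors[OF tree_Lev_ht[OF t]] by blast
    have "\<not> (u \<in> B \<and> v \<in> B)"
      using chain_ht_inj[of u v] uv Lev_tree Lev_ht chain by metis
    then show ?thesis using uv Lev_tree by (auto simp: below_def)
  qed
  then obtain \<alpha> where \<alpha>: "\<And>t. t \<in> Lev \<alpha> \<Longrightarrow> \<exists>d\<in>tree - B. d \<subseteq>\<^sub>m t"
    using dense_sealed[of "tree - B"] by blast
  obtain b where b: "b \<in> B" "ht b = \<alpha>" using ht by (metis UNIV_I image_iff)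
  then obtain d where d: "d \<in> tree" "d \<notin> B" "d \<subseteq>\<^sub>m b"
    using \<alpha>[of b] tree_Lev_ht[of b] sub by blast
  \<comment> \<open>The member of the branch at the height of \<open>d\<close> is also a restriction
    of \<open>b\<close>, hence equal to \<open>d\<close>.\<close>
  obtain b' where b': "b' \<in> B" "ht b' = ht d" using ht by (metis UNIV_I image_iff)
  have "d \<subset>\<^sub>m b" using d b by (auto simp: below_def)
  then have "ht d < ht b" using below_ht_less d(1) b(1) sub by blast
  then have "b' \<noteq> b" "\<not> b \<subset>\<^sub>m b'"
    using below_ht_less[of b b'] b' b(1) sub by (auto dest: less_asym)
  then have "b' \<subset>\<^sub>m b" using chain[OF b'(1) b(1)] by blast
  then have "b |` dom b' = b'" by (simp add: below_def map_le_iff_restrict)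
  moreover have "b |` dom d = d" using d(3) by (simp add: map_le_iff_restrict)
  moreover have "dom b' = dom d" 
    using b'(2) Lev_dom[OF tree_Lev_ht[OF d(1)]] Lev_dom[OF tree_Lev_ht[of b']] b'(1) sub by auto
  ultimately show False using d(2) b'(1) by metis
qed

text \<open>
  For an antichain \<open>A\<close>, the nodes that extend an element of \<open>A\<close> or are incompatible with all of \<open>A\<close>
  are dense, so that \<open>A\<close> does not reach beyond the level at which this dense set is sealed.
\<close>

lemma antichain_small:
  assumes A: "antichain tree A"
  shows "|A| <o (kappa :: 'k rel)"
proof -
  define D where "D = {t\<in>tree. (\<exists>a\<in>A. a \<subseteq>\<^sub>m t) \<or> \<not> (\<exists>u\<in>tree. t \<subseteq>\<^sub>m u \<and> (\<exists>a\<in>A. a \<subseteq>\<^sub>m u))}"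
  have "\<exists>d\<in>D. t \<subseteq>\<^sub>m d" if "t \<in> tree" for t
    using that map_le_refl unfolding D_def by blast
  moreover have "D \<subseteq> tree" by (auto simp: D_def)
  ultimately obtain \<alpha> where \<alpha>: "\<And>t. t \<in> Lev \<alpha> \<Longrightarrow> \<exists>d\<in>D. d \<subseteq>\<^sub>m t"
    using dense_sealed[of D] by blast
  have "A \<subseteq> (\<Union>\<beta>\<in>{..<osuc \<alpha>}. Lev \<beta>)"
  proof
    fix a assume a: "a \<in> A"
    then have at: "a \<in> tree" using A by (auto simp: antichain_def)
    have "ht a \<le> \<alpha>"
    proof (rule ccontr)
      assume "\<not> ht a \<le> \<alpha>"
      then have lt: "\<alpha> < ht a" by simp
      then have r: "a |` {..<\<alpha>} \<in> Lev \<alpha>" using Lev_restrict[OF tree_Lev_ht[OF at]] by simp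
      have ra: "a |` {..<\<alpha>} \<subseteq>\<^sub>m a" by (auto simp: map_le_def)
      obtain d where d: "d \<in> D" "d \<subseteq>\<^sub>m a |` {..<\<alpha>}" using \<alpha>[OF r] by blast
      then have "d \<subseteq>\<^sub>m a" using ra map_le_trans by blast
      \<comment> \<open>The second alternative in \<open>D\<close> fails for \<open>d\<close>,
        because \<open>a\<close> itself extends \<open>d\<close> and lies in
        \<open>A\<close>.\<close>
      then obtain a' where a': "a' \<in> A" "a' \<subseteq>\<^sub>m d"
        using d(1) a at map_le_refl unfolding D_def by blast
      have "a' \<subseteq>\<^sub>m a |` {..<\<alpha>}" using a'(2) d(2) map_le_trans by blast
      then have "dom a' \<subseteq> dom (a |` {..<\<alpha>})" by (rule map_le_implies_dom_le)
      then have "dom a' \<subseteq> {..<\<alpha>}" by auto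
      moreover have "\<alpha> \<in> dom a" using lt Lev_dom[OF tree_Lev_ht[OF at]] by simp
      ultimately have "a' \<noteq> a" by auto
      moreover have "a' \<subseteq>\<^sub>m a" using a'(2) \<open>d \<subseteq>\<^sub>m a\<close> map_le_trans by blast
      ultimately show False using A a a'(1) by (auto simp: antichain_def below_def)
    qed
    then show "a \<in> (\<Union>\<beta>\<in>{..<osuc \<alpha>}. Lev \<beta>)"
      using tree_Lev_ht[OF at] by (auto simp: less_osuc_iff)
  qed
  then show ?thesis by (rule small_mono) (intro small_UN small_lessThan Lev_small)
qed

lemma souslin_tree_tree: "souslin_tree tree"
  unfolding souslin_tree_def
  using streamlined_tree_tree no_cofinal_branch antichain_small not_ordLess_ordIso by blast

section \<open>Vanishing branches\<close>

text \<open>\<eta> is the union of the vanishing branch. Were it in \<open>K\<close>, it would be an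
  upper bound.\<close>

lemma vanishing_branch_limit:
  assumes \<alpha>: "\<alpha> \<in> V_minus K"
  obtains \<eta> where "dom \<eta> = {..<\<alpha>}" "\<eta> \<notin> K" "\<And>\<beta>. \<beta> < \<alpha> \<Longrightarrow> \<eta> |` {..<\<beta>} \<in> level K \<beta>"
proof -
  have lim: "limit_ord \<alpha>" using \<alpha> by (simp add: V_minus_def)
  obtain B where B: "branch K {..<\<alpha>} B" and van: "vanishing K B"
    using \<alpha> by (auto simp: V_minus_def)
  have sub: "B \<subseteq> K" and ht: "ht ` B = {..<\<alpha>}"
    and chain: "\<And>s t. s \<in> B \<Longrightarrow> t \<in> B \<Longrightarrow> s \<subset>\<^sub>m t \<or> s = t \<or> t \<subset>\<^sub>m s"
    using B by (auto simp: branch_def)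
  have lev: "s \<in> level K (ht s)" if "s \<in> K" for s
  proof -
    obtain \<beta> where "s \<in> seqs \<beta>" using \<open>s \<in> K\<close> tree_K unfolding streamlined_tree_def by blast
    then show ?thesis using that ht_eq[of s \<beta>] by (auto simp: level_def seqs_def)
  qed
  have dom: "dom s = {..<ht s}" if "s \<in> B" for s
    using lev that sub by (auto simp: level_def seqs_def)
  have "\<exists>s\<in>B. ht s = \<beta>" if "\<beta> < \<alpha>" for \<beta> using ht that by (metis image_iff lessThan_iff)
  then obtain b where b: "\<And>\<beta>. \<beta> < \<alpha> \<Longrightarrow> b \<beta> \<in> B \<and> ht (b \<beta>) = \<beta>" by metis
  \<comment> \<open>The node of height \<open>osuc y\<close> is the first one of the branch to have
    \<open>y\<close> in its domain.\<close>
  define \<eta> where "\<eta> y = (if y < \<alpha> then b (osuc y) y else None)" for y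
  have agree: "\<eta> y = s y" if s: "s \<in> B" "y < ht s" for s y
  proof -
    have "ht s < \<alpha>" using ht s(1) by blast
    then have y: "y < \<alpha>" using s(2) by simp
    then have bs: "b (osuc y) \<in> B" "ht (b (osuc y)) = osuc y"
      using b osuc_less_limit[OF lim] by auto
    have "y \<in> dom (b (osuc y))" "y \<in> dom s"
      using dom[OF bs(1)] dom[OF s(1)] bs(2) s(2) less_osuc by auto
    then have "b (osuc y) y = s y"
      using chain[OF bs(1) s(1)] unfolding below_def map_le_def by metis
    then show ?thesis using y by (simp add: \<eta>_def)
  qed
  show thesis
  proof (rule that[of \<eta>])
    have "y \<in> dom (b (osuc y))" if "y < \<alpha>" for y
      using dom b osuc_less_limit[OF lim that] less_osuc by auto
    then show "dom \<eta> = {..<\<alpha>}" by (force simp: \<eta>_def dom_def split: if_splits)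
    have "s \<subseteq>\<^sub>m \<eta>" if "s \<in> B" for s using agree[OF that] dom[OF that] by (simp add: map_le_def)
    then show "\<eta> \<notin> K" using van by (auto simp: vanishing_def)
    show "\<eta> |` {..<\<beta>} \<in> level K \<beta>" if "\<beta> < \<alpha>" for \<beta>
    proof -
      have "\<eta> |` {..<\<beta>} = b \<beta> |` {..<\<beta>}" using agree b[OF that] by (auto simp: restrict_eq_iff)
      also have "\<dots> = b \<beta>" using dom b[OF that] by (simp add: restrict_superset)
      finally show ?thesis using lev b[OF that] sub by (metis subsetD)
    qed
  qed
qed

text \<open>Otherwise \<open>t\<close> also follows some \<open>D\<close> with some \<xi> in level
  \<alpha> of \<open>K\<close>. At a common point \<delta> beyond both starts, the value of
  \<open>t\<close> codes both restrictions to \<delta>, which then agree. Cofinally many such points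
  give \<eta> = \<xi>, although only \<xi> is in \<open>K\<close>.\<close>

lemma follows_vanishing:
  assumes C: "C \<in> \<C> \<alpha>" and \<gamma>: "\<gamma> \<in> C" and lim: "limit_ord \<alpha>"
    and meet: "\<And>D \<beta>. D \<in> \<C> \<alpha> \<Longrightarrow> \<beta> < \<alpha> \<Longrightarrow> \<exists>\<delta>\<in>C \<inter> D. \<beta> < \<delta>"
    and \<eta>: "dom \<eta> = {..<\<alpha>}" "\<eta> \<notin> K" "\<And>\<beta>. \<beta> < \<alpha> \<Longrightarrow> \<eta> |` {..<\<beta>} \<in> level K \<beta>"
    and t: "follows C \<eta> \<gamma> \<alpha> t"
  shows "t \<notin> Lev \<alpha>"
proof
  assume "t \<in> Lev \<alpha>"
  then obtain D \<xi> \<gamma>' where D: "D \<in> \<C> \<alpha>" and \<xi>: "\<xi> \<in> level K \<alpha>" and \<gamma>': "\<gamma>' \<in> D"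
    and t': "follows D \<xi> \<gamma>' \<alpha> t"
    using Lev_iff[of t \<alpha>] lim by blast
  have "\<eta> y = \<xi> y" for y
  proof (cases "y < \<alpha>")
    case True
    then have "max y (max \<gamma> \<gamma>') < \<alpha>" using \<gamma> \<gamma>' \<C>_subset[OF C] \<C>_subset[OF D] by auto
    from meet[OF D this] obtain \<delta> where "\<delta> \<in> C \<inter> D" "max y (max \<gamma> \<gamma>') < \<delta>" by blast
    then have \<delta>: "\<delta> \<in> C" "\<delta> \<in> D" "y < \<delta>" "\<gamma> < \<delta>" "\<gamma>' < \<delta>" by auto
    have "\<delta> < \<alpha>" using \<C>_subset[OF C] \<delta>(1) by auto
    have "lab \<delta> \<eta> = lab \<delta> \<xi>"
      using t t' \<delta> \<open>\<delta> < \<alpha>\<close> unfolding follows_def by (metis less_imp_le option.inject)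
    then have "g \<delta> (\<eta> |` {..<\<delta>}) = g \<delta> (\<xi> |` {..<\<delta>})"
      unfolding lab_def by (rule injD[OF inj_von_neumann])
    then have "\<eta> |` {..<\<delta>} = \<xi> |` {..<\<delta>}"
      using inj_onD[OF inj_g] \<eta>(3) level_K_restrict[OF \<xi>] \<open>\<delta> < \<alpha>\<close> by (simp add: less_imp_le)
    then show ?thesis using \<delta>(3) by (simp add: restrict_eq_iff)
  next
    case False
    then have "y \<notin> dom \<eta>" "y \<notin> dom \<xi>" using \<eta>(1) \<xi> by (auto simp: level_def seqs_def)
    then show ?thesis by (simp add: domIff)
  qed
  then have "\<eta> = \<xi>" ..
  then show False using \<eta>(2) \<xi> by (simp add: level_def)
qed

text \<open>Above \<open>s\<close> one climbs along the limit \<eta> of a vanishing branch of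
  \<open>K\<close>; the proper restrictions of the resulting \<open>t\<close> form the required
  branch, since \<open>t\<close> is no node.\<close>

lemma V_minus_subset_V_full:
  assumes \<alpha>: "\<alpha> \<in> V_minus K"
    and meet: "\<And>C D \<beta>. C \<in> \<C> \<alpha> \<Longrightarrow> D \<in> \<C> \<alpha> \<Longrightarrow> \<beta> < \<alpha> \<Longrightarrow> \<exists>\<delta>\<in>C \<inter> D. \<beta> < \<delta>"
  shows "\<alpha> \<in> V_full tree"
proof -
  have lim: "limit_ord \<alpha>" using \<alpha> by (simp add: V_minus_def)
  obtain \<eta> where \<eta>: "dom \<eta> = {..<\<alpha>}" "\<eta> \<notin> K" "\<And>\<beta>. \<beta> < \<alpha> \<Longrightarrow> \<eta> |` {..<\<beta>} \<in> level K \<beta>"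
    using vanishing_branch_limit[OF \<alpha>] by blast
  have "\<exists>B. branch tree {..<\<alpha>} B \<and> vanishing tree B \<and> s \<in> B" if s: "s \<in> tree" "ht s < \<alpha>" for s
  proof -
    obtain C where C: "C \<in> \<C> \<alpha>" using \<C>_nonempty by blast
    obtain \<gamma> where \<gamma>: "\<gamma> \<in> C" "ht s < \<gamma>" using \<C>_cofinal[OF C lim s(2)] by blast
    obtain x where x: "x \<in> Lev \<gamma>" "s \<subseteq>\<^sub>m x"
      using Lev_extend[OF less_imp_le[OF \<gamma>(2)] tree_Lev_ht[OF s(1)]] by blast
    obtain t where t: "dom t = {..<\<alpha>}" "\<And>\<beta>. \<beta> < \<alpha> \<Longrightarrow> t |` {..<\<beta>} \<in> Lev \<beta>"
      "x \<subseteq>\<^sub>m t" "follows C \<eta> \<gamma> \<alpha> t"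
      using follows_exists[OF lim _ C \<eta>(3) \<gamma>(1) x(1)] Lev_extend by metis
    have "t \<notin> Lev \<alpha>" by (rule follows_vanishing[OF C \<gamma>(1) lim meet[OF C] \<eta> t(4)])
    define B where "B = (\<lambda>\<beta>. t |` {..<\<beta>}) ` {..<\<alpha>}"
    have "s = t |` {..<ht s}"
      using map_le_trans[OF x(2) t(3)] Lev_extends_iff[OF tree_Lev_ht[OF s(1)]] by simp
    then have "s \<in> B" using s(2) by (auto simp: B_def)
    moreover have "branch tree {..<\<alpha>} B"
      unfolding branch_def
    proof (intro conjI ballI)
      show "B \<subseteq> tree" using t(2) Lev_tree by (auto simp: B_def)
      have "ht (t |` {..<\<beta>}) = \<beta>" if "\<beta> < \<alpha>" for \<beta> using t(2)[OF that] Lev_ht by blast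
      then show "ht ` B = {..<\<alpha>}" by (force simp: B_def image_image)
      fix u v assume "u \<in> B" "v \<in> B"
      then obtain \<beta> \<beta>' where "u = t |` {..<\<beta>}" "v = t |` {..<\<beta>'}" by (auto simp: B_def)
      then have "u \<subseteq>\<^sub>m v \<or> v \<subseteq>\<^sub>m u"
        by (cases "\<beta> \<le> \<beta>'") (auto simp: map_le_def restrict_map_def)
      then show "u \<subset>\<^sub>m v \<or> u = v \<or> v \<subset>\<^sub>m u" by (auto simp: below_def)
    qed
    moreover have "vanishing tree B"
      unfolding vanishing_def
    proof
      assume "\<exists>u\<in>tree. \<forall>s\<in>B. s \<subseteq>\<^sub>m u"
      then obtain u where u: "u \<in> tree" "\<And>\<beta>. \<beta> < \<alpha> \<Longrightarrow> t |` {..<\<beta>} \<subseteq>\<^sub>m u"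
        by (auto simp: B_def)
      \<comment> \<open>An upper bound \<open>u\<close> agrees with \<open>t\<close> below \<alpha>,
        so \<open>t\<close> would be a restriction of a node and hence in
        \<open>Lev \<alpha>\<close>.\<close>
      have ut: "u y = t y" if "y < \<alpha>" for y
      proof -
        have "t |` {..<osuc y} \<subseteq>\<^sub>m u" using u(2) osuc_less_limit[OF lim that] by blast
        moreover have "y \<in> dom (t |` {..<osuc y})" using that less_osuc t(1) by auto
        ultimately show ?thesis using less_osuc[of y] by (simp add: map_le_def)
      qed
      then have "u |` {..<\<alpha>} = t |` {..<\<alpha>}" by (simp add: restrict_eq_iff)
      then have eq: "u |` {..<\<alpha>} = t" using t(1) by (simp add: restrict_superset)
      have "{..<\<alpha>} \<subseteq> dom u" using ut t(1) by (auto simp: dom_def set_eq_iff)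
      then have "\<alpha> \<le> ht u"
        using Lev_dom[OF tree_Lev_ht[OF u(1)]] by (metis lessThan_subset_iff)
      from Lev_restrict[OF tree_Lev_ht[OF u(1)] this] eq \<open>t \<notin> Lev \<alpha>\<close> show False by simp
    qed
    ultimately show ?thesis by blast
  qed
  then show ?thesis using lim by (simp add: V_full_def)
qed

end

section \<open>Assembly of the two cases\<close>

text \<open>Two distinct elements would give an injection of \<open>bool\<close> into
  \<open>A\<close>.\<close>

lemma ordLess_ctwoD: "|A| <o ctwo \<Longrightarrow> x \<in> A \<Longrightarrow> y \<in> A \<Longrightarrow> x = y"
proof (rule ccontr)
  assume A: "|A| <o ctwo" "x \<in> A" "y \<in> A" "x \<noteq> y"
  have "inj (\<lambda>b::bool. if b then x else y)" "range (\<lambda>b::bool. if b then x else y) \<subseteq> A"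
    using A by (auto simp: inj_on_def)
  then have "ctwo \<le>o |A|" unfolding ctwo_def
    by (intro card_of_ordLeq[THEN iffD1] exI conjI)
  then show False using A(1) not_ordLeq_ordLess by blast
qed

lemma proxy_PE:
  fixes R :: "'k::wellorder set \<Rightarrow> 'k set \<Rightarrow> bool"
  assumes "proxy_P \<mu> R"
  obtains S \<C> where "\<And>A. stationary {\<alpha>. A \<inter> {..<\<alpha>} = (S \<alpha> :: 'k set)}"
    "\<And>\<alpha>::'k. \<C> \<alpha> \<noteq> {}" "\<And>\<alpha>. |\<C> \<alpha>| <o \<mu>"
    "\<And>\<alpha> C. C \<in> \<C> \<alpha> \<Longrightarrow> closed_subset {..<\<alpha>} C"
    "\<And>\<alpha> C. C \<in> \<C> \<alpha> \<Longrightarrow> osup C = osup {..<\<alpha>}"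
    "\<And>\<alpha> C \<alpha>'. C \<in> \<C> \<alpha> \<Longrightarrow> \<alpha>' \<in> acc_pts C \<Longrightarrow> \<exists>D\<in>\<C> \<alpha>'. R D C"
    "\<And>B. cofinal_kappa B \<Longrightarrow> stationary {\<alpha>. \<forall>C\<in>\<C> \<alpha>. osup (nacc_pts C \<inter> B) = \<alpha>}"
proof -
  obtain S :: "'k \<Rightarrow> 'k set" where "\<forall>A. stationary {\<alpha>. A \<inter> {..<\<alpha>} = S \<alpha>}"
    using assms unfolding proxy_P_def diamond_def by blast
  moreover from assms obtain \<C> where
    "\<forall>\<alpha>. \<C> \<alpha> \<noteq> {} \<and> |\<C> \<alpha>| <o \<mu> \<and>
       (\<forall>C\<in>\<C> \<alpha>. closed_subset {..<\<alpha>} C \<and> osup C = osup {..<\<alpha>})"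
    "\<forall>\<alpha>. \<forall>C\<in>\<C> \<alpha>. \<forall>\<alpha>'\<in>acc_pts C. \<exists>D\<in>\<C> \<alpha>'. R D C"
    "\<forall>B. cofinal_kappa B \<longrightarrow> stationary {\<alpha>. \<forall>C\<in>\<C> \<alpha>. osup (nacc_pts C \<inter> B) = \<alpha>}"
    unfolding proxy_P_def by (elim conjE exE)
  ultimately show thesis by (intro that[of S \<C>]) simp_all
qed

text \<open>One construction serves both cases. How members of \<open>\<C> \<alpha>\<close> are
  shown to meet cofinally differs between them, so this remains a condition on each
  \<alpha>.\<close>

lemma (in regular_uncountable) souslin_tree_exists:
  fixes K :: "'k node set" and S :: "'k \<Rightarrow> 'k set"
  assumes K: "streamlined_tree K"
    and S: "\<And>A. stationary {\<alpha>. A \<inter> {..<\<alpha>} = S \<alpha>}"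
    and \<C>: "\<And>\<alpha>. \<C> \<alpha> \<noteq> {}" "\<And>\<alpha>. |\<C> \<alpha>| <o (kappa :: 'k rel)"
      "\<And>\<alpha> C. C \<in> \<C> \<alpha> \<Longrightarrow> closed_subset {..<\<alpha>} C"
      "\<And>\<alpha> C. C \<in> \<C> \<alpha> \<Longrightarrow> osup C = osup {..<\<alpha>}"
      "\<And>\<alpha> C \<alpha>'. C \<in> \<C> \<alpha> \<Longrightarrow> \<alpha>' \<in> acc_pts C \<Longrightarrow> \<exists>D\<in>\<C> \<alpha>'. D \<sqsubseteq>\<^sub>* C"
      "\<And>B. cofinal_kappa B \<Longrightarrow> stationary {\<alpha>. \<forall>C\<in>\<C> \<alpha>. osup (nacc_pts C \<inter> B) = \<alpha>}"
  shows "\<exists>T :: 'k node set. normal_tree T \<and> splitting_tree T \<and> souslin_tree T \<and>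
    (\<forall>\<alpha>\<in>V_minus K. (\<forall>C\<in>\<C> \<alpha>. \<forall>D\<in>\<C> \<alpha>. \<forall>\<beta><\<alpha>. \<exists>\<delta>\<in>C \<inter> D. \<beta> < \<delta>) \<longrightarrow> \<alpha> \<in> V_full T)"
proof -
  obtain e :: "'k node \<Rightarrow> 'k" where e: "inj_on e coded_nodes"
    using diamond_coding[OF S] by blast
  have "\<exists>f :: 'k node \<Rightarrow> 'k. inj_on f (level K \<alpha>)" for \<alpha>
  proof -
    have "|level K \<alpha>| \<le>o |UNIV :: 'k set|"
      using K card_of_UNIV_kappa unfolding streamlined_tree_def
      by (meson ordIso_symmetric ordLess_imp_ordLeq ordLess_ordIso_trans)
    then show ?thesis using card_of_ordLeq[of "level K \<alpha>" "UNIV :: 'k set"] by auto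
  qed
  then obtain g :: "'k \<Rightarrow> 'k node \<Rightarrow> 'k" where g: "\<And>\<alpha>. inj_on (g \<alpha>) (level K \<alpha>)" by metis
  interpret souslin_construction ty K \<C> S e g
    by unfold_locales (fact K \<C> S e g)+
  show ?thesis
    using normal_tree_tree splitting_tree_tree souslin_tree_tree V_minus_subset_V_full by blast
qed

theorem theorem3p7:
  fixes K :: "'k::wellorder node set"
  assumes "Card_order (kappa :: 'k rel)"
    and "regularCard (kappa :: 'k rel)"
    and "natLeq <o (kappa :: 'k rel)"
    and "streamlined_tree K"
  shows "(proxy_P ctwo (init_seg_star :: 'k set \<Rightarrow> 'k set \<Rightarrow> bool) \<longrightarrow>
           (\<exists>T :: 'k node set. normal_tree T \<and> splitting_tree T \<and> souslin_tree T \<and>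
              V_minus K \<subseteq> V_full T)) \<and>
         (proxy_P (kappa :: 'k rel) (init_seg :: 'k set \<Rightarrow> 'k set \<Rightarrow> bool) \<longrightarrow>
           (\<exists>T :: 'k node set. normal_tree T \<and> splitting_tree T \<and> souslin_tree T \<and>
              V_minus K \<inter> E_gt_omega \<subseteq> V_full T))"
proof (intro conjI impI)
  interpret regular_uncountable "TYPE('k)"
    using assms(1-3) by unfold_locales
  {
    assume "proxy_P ctwo (init_seg_star :: 'k set \<Rightarrow> 'k set \<Rightarrow> bool)"
    then obtain S \<C> where S: "\<And>A. stationary {\<alpha>. A \<inter> {..<\<alpha>} = (S \<alpha> :: 'k set)}"
      and ne: "\<And>\<alpha>::'k. \<C> \<alpha> \<noteq> {}" and two: "\<And>\<alpha>. |\<C> \<alpha>| <o ctwo"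
      and closed: "\<And>\<alpha> C. C \<in> \<C> \<alpha> \<Longrightarrow> closed_subset {..<\<alpha>} C"
      and osup: "\<And>\<alpha> C. C \<in> \<C> \<alpha> \<Longrightarrow> osup C = osup {..<\<alpha>}"
      and coh: "\<And>\<alpha> C \<alpha>'. C \<in> \<C> \<alpha> \<Longrightarrow> \<alpha>' \<in> acc_pts C \<Longrightarrow> \<exists>D\<in>\<C> \<alpha>'. D \<sqsubseteq>\<^sub>* C"
      and guess: "\<And>B. cofinal_kappa B \<Longrightarrow> stationary {\<alpha>. \<forall>C\<in>\<C> \<alpha>. osup (nacc_pts C \<inter> B) = \<alpha>}"
      by (rule proxy_PE) blast
    have small: "|\<C> \<alpha>| <o (kappa :: 'k rel)" for \<alpha>
    proof -
      obtain C where "C \<in> \<C> \<alpha>" using ne by blast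
      then have "\<C> \<alpha> \<subseteq> {C}" using ordLess_ctwoD[OF two] by blast
      then show ?thesis using small_finite finite_subset by blast
    qed
    have "\<exists>T :: 'k node set. normal_tree T \<and> splitting_tree T \<and> souslin_tree T \<and>
        (\<forall>\<alpha>\<in>V_minus K. (\<forall>C\<in>\<C> \<alpha>. \<forall>D\<in>\<C> \<alpha>. \<forall>\<beta><\<alpha>. \<exists>\<delta>\<in>C \<inter> D. \<beta> < \<delta>) \<longrightarrow> \<alpha> \<in> V_full T)"
      by (rule souslin_tree_exists[OF assms(4) S ne small]) (fact closed osup coh guess)+
    then obtain T where T: "normal_tree T" "splitting_tree T" "souslin_tree T"
      and V: "\<And>\<alpha>. \<alpha> \<in> V_minus K \<Longrightarrow>
        \<forall>C\<in>\<C> \<alpha>. \<forall>D\<in>\<C> \<alpha>. \<forall>\<beta><\<alpha>. \<exists>\<delta>\<in>C \<inter> D. \<beta> < \<delta> \<Longrightarrow> \<alpha> \<in> V_full T"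
      by blast
    have "\<alpha> \<in> V_full T" if \<alpha>: "\<alpha> \<in> V_minus K" for \<alpha>
    proof (rule V[OF \<alpha>], intro ballI allI impI)
      fix C D \<beta> assume CD: "C \<in> \<C> \<alpha>" "D \<in> \<C> \<alpha>" and \<beta>: "\<beta> < \<alpha>"
      have "limit_ord \<alpha>" using \<alpha> by (simp add: V_minus_def)
      then have "osup C = \<alpha>" using osup[OF CD(1)] osup_lessThan_limit by simp
      moreover have "C \<subseteq> {..<\<alpha>}" using closed[OF CD(1)] by (simp add: closed_subset_def)
      \<comment> \<open>The family \<open>\<C> \<alpha>\<close> is a singleton, so the intersection
        is \<open>C\<close>, which is cofinal.\<close>
      moreover have "D = C" using ordLess_ctwoD[OF two] CD by blast
      ultimately show "\<exists>\<delta>\<in>C \<inter> D. \<beta> < \<delta>" using osup_eq_iff[of C \<alpha>] \<beta> by simp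
    qed
    then show "\<exists>T :: 'k node set. normal_tree T \<and> splitting_tree T \<and> souslin_tree T \<and>
        V_minus K \<subseteq> V_full T"
      using T by blast
  }
  assume "proxy_P (kappa :: 'k rel) (init_seg :: 'k set \<Rightarrow> 'k set \<Rightarrow> bool)"
  then obtain S \<C> where S: "\<And>A. stationary {\<alpha>. A \<inter> {..<\<alpha>} = (S \<alpha> :: 'k set)}"
    and ne: "\<And>\<alpha>::'k. \<C> \<alpha> \<noteq> {}" and small: "\<And>\<alpha>. |\<C> \<alpha>| <o (kappa :: 'k rel)"
    and closed: "\<And>\<alpha> C. C \<in> \<C> \<alpha> \<Longrightarrow> closed_subset {..<\<alpha>} C"
    and osup: "\<And>\<alpha> C. C \<in> \<C> \<alpha> \<Longrightarrow> osup C = osup {..<\<alpha>}"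
    and coh: "\<And>\<alpha> C \<alpha>'. C \<in> \<C> \<alpha> \<Longrightarrow> \<alpha>' \<in> acc_pts C \<Longrightarrow> \<exists>D\<in>\<C> \<alpha>'. D \<sqsubseteq>\<^sub>i C"
    and guess: "\<And>B. cofinal_kappa B \<Longrightarrow> stationary {\<alpha>. \<forall>C\<in>\<C> \<alpha>. osup (nacc_pts C \<inter> B) = \<alpha>}"
    by (rule proxy_PE) blast
  have coh': "\<exists>D\<in>\<C> \<alpha>'. D \<sqsubseteq>\<^sub>* C" if C: "C \<in> \<C> \<alpha>" "\<alpha>' \<in> acc_pts C" for \<alpha> C \<alpha>'
  proof -
    obtain D where D: "D \<in> \<C> \<alpha>'" "D \<sqsubseteq>\<^sub>i C" using coh[OF C] by blast
    have "osup D = \<alpha>'"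
      using osup[OF D(1)] osup_lessThan_limit[OF acc_pts_limit[OF C(2)]] by simp
    \<comment> \<open>The witness for \<open>\<sqsubseteq>\<^sub>*\<close> is \<epsilon> =
      \<open>ord_zero\<close>: nothing is cut off, and it lies below \<open>osup D\<close> because
      accumulation points are positive.\<close>
    then have "ord_zero < osup D" using C(2) by (simp add: acc_pts_iff)
    moreover have "{..<ord_zero} = ({} :: 'k set)" using not_less_ord_zero by auto
    ultimately have "D \<sqsubseteq>\<^sub>* C" using D(2) by (auto simp: init_seg_star_def)
    then show ?thesis using D(1) by blast
  qed
  have "\<exists>T :: 'k node set. normal_tree T \<and> splitting_tree T \<and> souslin_tree T \<and>
      (\<forall>\<alpha>\<in>V_minus K. (\<forall>C\<in>\<C> \<alpha>. \<forall>D\<in>\<C> \<alpha>. \<forall>\<beta><\<alpha>. \<exists>\<delta>\<in>C \<inter> D. \<beta> < \<delta>) \<longrightarrow> \<alpha> \<in> V_full T)"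
    by (rule souslin_tree_exists[OF assms(4) S ne small]) (fact closed osup coh' guess)+
  then obtain T where T: "normal_tree T" "splitting_tree T" "souslin_tree T"
    and V: "\<And>\<alpha>. \<alpha> \<in> V_minus K \<Longrightarrow>
      \<forall>C\<in>\<C> \<alpha>. \<forall>D\<in>\<C> \<alpha>. \<forall>\<beta><\<alpha>. \<exists>\<delta>\<in>C \<inter> D. \<beta> < \<delta> \<Longrightarrow> \<alpha> \<in> V_full T"
    by blast
  have "\<alpha> \<in> V_full T" if \<alpha>: "\<alpha> \<in> V_minus K" "\<alpha> \<in> E_gt_omega" for \<alpha>
  proof (rule V[OF \<alpha>(1)], intro ballI allI impI)
    have lim: "limit_ord \<alpha>" using \<alpha> by (simp add: V_minus_def)
    have cof: "\<exists>\<gamma>\<in>C. \<beta> < \<gamma>" if "C \<in> \<C> \<alpha>" "\<beta> < \<alpha>" for C \<beta>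
    proof -
      have "osup C = \<alpha>" using osup[OF that(1)] osup_lessThan_limit[OF lim] by simp
      moreover have "C \<subseteq> {..<\<alpha>}" using closed[OF that(1)] by (simp add: closed_subset_def)
      ultimately show ?thesis using osup_eq_iff[of C \<alpha>] that(2) by simp
    qed
    fix C D \<beta> assume CD: "C \<in> \<C> \<alpha>" "D \<in> \<C> \<alpha>" and \<beta>: "\<beta> < \<alpha>"
    show "\<exists>\<delta>\<in>C \<inter> D. \<beta> < \<delta>"
      by (rule closed_cofinal_Int[OF \<alpha>(2) closed[OF CD(1)] cof[OF CD(1)]
            closed[OF CD(2)] cof[OF CD(2)] \<beta>])
  qed
  then show "\<exists>T :: 'k node set. normal_tree T \<and> splitting_tree T \<and> souslin_tree T \<and>
      V_minus K \<inter> E_gt_omega \<subseteq> V_full T"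
    using T by blast
qed

end
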